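(* Let $\mathfrak A$ be a compact set of first-order $\Sigma$-structures and $\Gamma$ a set of HoCHCs. Then $\Gamma$ is $\mathfrak A$-unsatisfiable if and only if $\Gamma\vdash_{\mathfrak A}^*\Gamma'\cup\{\bot\}$ for some $\Gamma'$.
   Context: Types. Fix a base type $\iota$. Argument types $\tau::=\iota\mid\rho$; relational types $\rho::=o\mid\tau\to\rho$; first-order types $\sigma_{FO}::=\iota\mid\iota\to o\mid\iota\to\sigma_{FO}$; types $\sigma::=\rho\mid\sigma_{FO}$. A fixed type environment $\Delta$ maps variables to argument types, $\Delta^{-1}(\tau)$ infinite for each $\tau$. Signatures are sets of typed symbols distinct from variables and the logical symbols $\neg,\land,\lor,\exists_\tau$. Terms: $M::=x\mid c\mid\neg\mid\land\mid\lor\mid\exists_\tau\mid MM\mid\lambda x.M$, simply typed ($\lambda x.M:\Delta(x)\to\rho$ only for $M$ of relational type $\rho$; $\land,\lor:o\to o\to o$; $\neg M:o$ for $M:o$; $\exists_\tau:(\tau\to o)\to o$). Formulas have type $o$. A first-order $\Sigma$-formula uses only symbols of first-order type, variables of type $\iota$, no $\lambda$. Semantics (standard): given a first-order $\Sigma$-structure $\mathcal A$ with domain $D=\mathcal A[\![\iota]\!]$, each type is interpreted by $D$, $\{0,1\}$, or the set of all functions; a $\Sigma'$-expansion $\mathcal B$ of $\mathcal A$ interprets the symbols of $\Sigma'\setminus\Sigma$ in these sets and agrees with $\mathcal A$ on $\Sigma$; terms are interpreted in the usual way ($\exists_\tau$ as maximum over the domain of $\tau$); $\mathcal B\models F$ means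 $F$ is true under all valuations. Clauses: fix a first-order signature $\Sigma$ and $\Sigma'\supseteq\Sigma$ adding only relational-typed symbols. An atom is a $\Sigma'$-formula with no logical symbols; a background atom is one that is a first-order $\Sigma$-formula. Goal clause $\neg A_1\lor\cdots\lor\neg A_n$ ($\bot$ for $n=0$); definite clause $G\lor R\,x_1\cdots x_n$ with $R\in\Sigma'\setminus\Sigma$, $x_i$ distinct variables; HoCHC: goal or definite clause, free variables universally quantified. Satisfiability: a set $\Gamma$ of HoCHCs is $\mathfrak A$-satisfiable if for some $\mathcal A\in\mathfrak A$ there is a $\Sigma'$-expansion $\mathcal B$ of $\mathcal A$ (standard semantics) with $\mathcal B\models C$ for all $C\in\Gamma$; otherwise $\mathfrak A$-unsatisfiable. For goal clauses consisting only of background atoms this means some $\mathcal A\in\mathfrak A$ satisfies them all. $\mathfrak A$ is compact if every $\mathfrak A$-unsatisfiable set of goal clauses of background atoms has a finite $\mathfrak A$-unsatisfiable subset. Proof system $\vdash_{\mathfrak A}$ (rules applied modulo renaming of free variables; $\Gamma'\vdash_{\mathfrak A}\Gamma'\cup\{G\}$ if $G$ is derived from clauses of $\Gamma'$ by one rule; $\vdash^*_{\mathfrak A}$ its reflexive-transitive closure): Resolution: from $\neg R\,M_1\cdots M_n\lor G$ and $G'\lor R\,x_1\cdots x_n$ derive $G\lor G'[M_1/x_1,\dots,M_n/x_n]$. $\beta$-Reduction: from $\neg(\lambda x.L)M\,N_1\cdots N_k\lor G$ derive $\neg L[M/x]N_1\cdots N_k\lor G$. Compact constraint refutation: from clauses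 $G_j\lor\neg\phi_{j,1}\lor\cdots\lor\neg\phi_{j,m_j}$ ($1\le j\le n$) derive $\bot$, provided every atom in each $G_j$ has the form $x\,M_1\cdots M_k$ with $x$ a variable, each $\phi_{j,i}$ is a background atom, and $\{\neg\phi_{j,1}\lor\cdots\lor\neg\phi_{j,m_j}\mid 1\le j\le n\}$ is $\mathfrak A$-unsatisfiable. *)

theory Defs
  imports Main "HOL-Library.Multiset" "HOL-Library.FuncSet"
begin

datatype ty = Ind | Prop | Arr ty ty

fun relational :: "ty \<Rightarrow> bool" where
  "relational Ind \<longleftrightarrow> False"
| "relational Prop \<longleftrightarrow> True"
| "relational (Arr \<sigma> \<tau>) \<longleftrightarrow> (\<sigma> = Ind \<or> relational \<sigma>) \<and> relational \<tau>"

definition argument_type :: "ty \<Rightarrow> bool" where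
  "argument_type \<tau> \<longleftrightarrow> \<tau> = Ind \<or> relational \<tau>"

fun fo_type :: "ty \<Rightarrow> bool" where
  "fo_type Ind \<longleftrightarrow> True"
| "fo_type Prop \<longleftrightarrow> False"
| "fo_type (Arr \<sigma> \<tau>) \<longleftrightarrow> \<sigma> = Ind \<and> (\<tau> = Prop \<or> fo_type \<tau>)"

text \<open>Terms modulo renaming of bound variables, in locally nameless form: bound variables are
  de Bruijn indices, free variables are named and typed by the environment. As the environment has
  variables of every argument type, the terms \<open>Lam \<tau> M\<close> are the classes of the abstractions over
  a variable of type \<open>\<tau>\<close>.\<close>

datatype ('c, 'x) trm =
    Bound nat
  | Free 'x
  | Sym 'c
  | Neg
  | Conj
  | Disj
  | Exi ty
  | App "('c, 'x) trm" "('c, 'x) trm"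
  | Lam ty "('c, 'x) trm"

abbreviation apps :: "('c, 'x) trm \<Rightarrow> ('c, 'x) trm list \<Rightarrow> ('c, 'x) trm" where
  "apps M Ns \<equiv> foldl App M Ns"

text \<open>\<open>vty\<close> is the type environment, \<open>bsig\<close> the first-order signature and \<open>sig\<close> its relational
  extension. \<open>tys\<close> is the stock of types that terms may use and that structures have to interpret.
  The usual language is the case where it consists of all types. It is a parameter because the full
  function hierarchy at all finite types over an infinite domain does not fit into any one type that
  HOL can construct, whereas the part of it over finitely many types does.\<close>

record ('c, 'x) lang =
  tys :: "ty set"
  cty :: "'c \<Rightarrow> ty"
  vty :: "'x \<Rightarrow> ty"
  bsig :: "'c set"
  sig :: "'c set"

definition language :: "('c, 'x) lang \<Rightarrow> bool" where
  "language L \<longleftrightarrow>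
     (\<forall>\<sigma>\<in>tys L. relational \<sigma> \<or> fo_type \<sigma>) \<and>
     Ind \<in> tys L \<and> Prop \<in> tys L \<and>
     (\<forall>\<sigma> \<tau>. Arr \<sigma> \<tau> \<in> tys L \<longrightarrow> \<sigma> \<in> tys L \<and> \<tau> \<in> tys L) \<and>
     (\<forall>x. argument_type (vty L x)) \<and>
     (\<forall>\<tau>. argument_type \<tau> \<longrightarrow> infinite {x. vty L x = \<tau>}) \<and>
     bsig L \<subseteq> sig L \<and>
     (\<forall>c\<in>sig L. cty L c \<in> tys L) \<and>
     (\<forall>c\<in>bsig L. fo_type (cty L c)) \<and>
     (\<forall>c\<in>sig L - bsig L. relational (cty L c))"

definition usable :: "('c, 'x) lang \<Rightarrow> ty \<Rightarrow> ty option" where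
  "usable L \<sigma> = (if \<sigma> \<in> tys L then Some \<sigma> else None)"

text \<open>The type of a term over \<open>sig L\<close>, where the list gives the types of the dangling indices.\<close>

fun ty_of :: "('c, 'x) lang \<Rightarrow> ty list \<Rightarrow> ('c, 'x) trm \<Rightarrow> ty option" where
  "ty_of L Ts (Bound i) = (if i < length Ts then Some (Ts ! i) else None)"
| "ty_of L Ts (Free x) = usable L (vty L x)"
| "ty_of L Ts (Sym c) = (if c \<in> sig L then Some (cty L c) else None)"
| "ty_of L Ts Neg = usable L (Arr Prop Prop)"
| "ty_of L Ts Conj = usable L (Arr Prop (Arr Prop Prop))"
| "ty_of L Ts Disj = usable L (Arr Prop (Arr Prop Prop))"
| "ty_of L Ts (Exi \<tau>) =
     (if argument_type \<tau> then usable L (Arr (Arr \<tau> Prop) Prop) else None)"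
| "ty_of L Ts (App M N) =
     (case ty_of L Ts M of
        Some (Arr \<sigma> \<tau>) \<Rightarrow> if ty_of L Ts N = Some \<sigma> then Some \<tau> else None
      | _ \<Rightarrow> None)"
| "ty_of L Ts (Lam \<tau> M) =
     (case ty_of L (\<tau> # Ts) M of
        Some \<rho> \<Rightarrow> if argument_type \<tau> \<and> relational \<rho> then usable L (Arr \<tau> \<rho>) else None
      | None \<Rightarrow> None)"

definition formula :: "('c, 'x) lang \<Rightarrow> ('c, 'x) trm \<Rightarrow> bool" where
  "formula L M \<longleftrightarrow> ty_of L [] M = Some Prop"

fun logic_free :: "('c, 'x) trm \<Rightarrow> bool" where
  "logic_free (Bound i) \<longleftrightarrow> True"
| "logic_free (Free x) \<longleftrightarrow> True"
| "logic_free (Sym c) \<longleftrightarrow> True"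
| "logic_free Neg \<longleftrightarrow> False"
| "logic_free Conj \<longleftrightarrow> False"
| "logic_free Disj \<longleftrightarrow> False"
| "logic_free (Exi \<tau>) \<longleftrightarrow> False"
| "logic_free (App M N) \<longleftrightarrow> logic_free M \<and> logic_free N"
| "logic_free (Lam \<tau> M) \<longleftrightarrow> logic_free M"

fun first_order :: "('c, 'x) lang \<Rightarrow> ('c, 'x) trm \<Rightarrow> bool" where
  "first_order L (Bound i) \<longleftrightarrow> False"
| "first_order L (Free x) \<longleftrightarrow> vty L x = Ind"
| "first_order L (Sym c) \<longleftrightarrow> c \<in> bsig L"
| "first_order L Neg \<longleftrightarrow> True"
| "first_order L Conj \<longleftrightarrow> True"
| "first_order L Disj \<longleftrightarrow> True"
| "first_order L (Exi \<tau>) \<longleftrightarrow> \<tau> = Ind"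
| "first_order L (App M N) \<longleftrightarrow> first_order L M \<and> first_order L N"
| "first_order L (Lam \<tau> M) \<longleftrightarrow> False"

definition atom :: "('c, 'x) lang \<Rightarrow> ('c, 'x) trm \<Rightarrow> bool" where
  "atom L A \<longleftrightarrow> formula L A \<and> logic_free A"

definition background_atom :: "('c, 'x) lang \<Rightarrow> ('c, 'x) trm \<Rightarrow> bool" where
  "background_atom L A \<longleftrightarrow> atom L A \<and> first_order L A"

text \<open>\<open>Goal {#A\<^sub>1, \<dots>, A\<^sub>n#}\<close> is the disjunction of the negated atoms \<open>A\<^sub>i\<close>, and
  \<open>Definite {#A\<^sub>1, \<dots>, A\<^sub>n#} R [x\<^sub>1, \<dots>, x\<^sub>m]\<close> is the same disjunction with the additional positive
  literal \<open>R x\<^sub>1 \<dots> x\<^sub>m\<close>. Multisets make the order of the literals irrelevant.\<close>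

datatype ('c, 'x) clause =
    Goal "('c, 'x) trm multiset"
  | Definite "('c, 'x) trm multiset" 'c "'x list"

abbreviation Bottom :: "('c, 'x) clause" where
  "Bottom \<equiv> Goal {#}"

fun hochc :: "('c, 'x) lang \<Rightarrow> ('c, 'x) clause \<Rightarrow> bool" where
  "hochc L (Goal G) \<longleftrightarrow> (\<forall>A\<in>#G. atom L A)"
| "hochc L (Definite G R xs) \<longleftrightarrow>
     (\<forall>A\<in>#G. atom L A) \<and> R \<in> sig L - bsig L \<and> distinct xs \<and>
     formula L (apps (Sym R) (map Free xs))"

definition background_goal :: "('c, 'x) lang \<Rightarrow> ('c, 'x) clause \<Rightarrow> bool" where
  "background_goal L C \<longleftrightarrow> (\<exists>G. C = Goal G \<and> (\<forall>A\<in>#G. background_atom L A))"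

text \<open>A structure comes with the interpretation \<open>Dom\<close> of the types in a type of values \<open>'v\<close>, in
  which functions are represented by codes to be applied with \<open>app\<close>, and truth values by \<open>truth\<close>.
  In a standard structure the codes of type \<open>Arr \<sigma> \<tau>\<close> correspond one-to-one to all functions from
  \<open>Dom A \<sigma>\<close> to \<open>Dom A \<tau>\<close>.\<close>

record ('c, 'v) struct =
  Dom :: "ty \<Rightarrow> 'v set"
  app :: "'v \<Rightarrow> 'v \<Rightarrow> 'v"
  truth :: "bool \<Rightarrow> 'v"
  itp :: "'c \<Rightarrow> 'v"

definition standard :: "('c, 'x) lang \<Rightarrow> ('c, 'v) struct \<Rightarrow> bool" where
  "standard L A \<longleftrightarrow>
     Dom A Ind \<noteq> {} \<and>
     inj (truth A) \<and> Dom A Prop = range (truth A) \<and>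
     (\<forall>\<sigma> \<tau>. Arr \<sigma> \<tau> \<in> tys L \<longrightarrow>
        bij_betw (\<lambda>f. restrict (app A f) (Dom A \<sigma>)) (Dom A (Arr \<sigma> \<tau>)) (Dom A \<sigma> \<rightarrow>\<^sub>E Dom A \<tau>))"

definition fo_structure :: "('c, 'x) lang \<Rightarrow> ('c, 'v) struct \<Rightarrow> bool" where
  "fo_structure L A \<longleftrightarrow> standard L A \<and> (\<forall>c\<in>bsig L. itp A c \<in> Dom A (cty L c))"

definition expansion :: "('c, 'x) lang \<Rightarrow> ('c, 'v) struct \<Rightarrow> ('c, 'v) struct \<Rightarrow> bool" where
  "expansion L A B \<longleftrightarrow>
     Dom B = Dom A \<and> app B = app A \<and> truth B = truth A \<and>
     (\<forall>c\<in>bsig L. itp B c = itp A c) \<and>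
     (\<forall>c\<in>sig L - bsig L. itp B c \<in> Dom B (cty L c))"

definition fn_code :: "('c, 'v) struct \<Rightarrow> ty \<Rightarrow> ty \<Rightarrow> ('v \<Rightarrow> 'v) \<Rightarrow> 'v" where
  "fn_code A \<sigma> \<tau> g = (THE f. f \<in> Dom A (Arr \<sigma> \<tau>) \<and> (\<forall>v\<in>Dom A \<sigma>. app A f v = g v))"

definition holds :: "('c, 'v) struct \<Rightarrow> 'v \<Rightarrow> bool" where
  "holds A v \<longleftrightarrow> v = truth A True"

text \<open>\<open>eval L A \<alpha> e M\<close>: the valuation \<open>\<alpha>\<close> interprets the free variables, and \<open>e\<close> lists the types
  and values of the dangling indices.\<close>

fun eval :: "('c, 'x) lang \<Rightarrow> ('c, 'v) struct \<Rightarrow> ('x \<Rightarrow> 'v) \<Rightarrow> (ty \<times> 'v) list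
    \<Rightarrow> ('c, 'x) trm \<Rightarrow> 'v" where
  "eval L A \<alpha> e (Bound i) = snd (e ! i)"
| "eval L A \<alpha> e (Free x) = \<alpha> x"
| "eval L A \<alpha> e (Sym c) = itp A c"
| "eval L A \<alpha> e Neg = fn_code A Prop Prop (\<lambda>u. truth A (\<not> holds A u))"
| "eval L A \<alpha> e Conj =
     fn_code A Prop (Arr Prop Prop)
       (\<lambda>u. fn_code A Prop Prop (\<lambda>v. truth A (holds A u \<and> holds A v)))"
| "eval L A \<alpha> e Disj =
     fn_code A Prop (Arr Prop Prop)
       (\<lambda>u. fn_code A Prop Prop (\<lambda>v. truth A (holds A u \<or> holds A v)))"
| "eval L A \<alpha> e (Exi \<tau>) =
     fn_code A (Arr \<tau> Prop) Prop (\<lambda>f. truth A (\<exists>v\<in>Dom A \<tau>. holds A (app A f v)))"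
| "eval L A \<alpha> e (App M N) = app A (eval L A \<alpha> e M) (eval L A \<alpha> e N)"
| "eval L A \<alpha> e (Lam \<tau> M) =
     fn_code A \<tau> (the (ty_of L (\<tau> # map fst e) M)) (\<lambda>v. eval L A \<alpha> ((\<tau>, v) # e) M)"

definition valuation :: "('c, 'x) lang \<Rightarrow> ('c, 'v) struct \<Rightarrow> ('x \<Rightarrow> 'v) \<Rightarrow> bool" where
  "valuation L A \<alpha> \<longleftrightarrow> (\<forall>x. vty L x \<in> tys L \<longrightarrow> \<alpha> x \<in> Dom A (vty L x))"

definition true_at :: "('c, 'x) lang \<Rightarrow> ('c, 'v) struct \<Rightarrow> ('x \<Rightarrow> 'v) \<Rightarrow> ('c, 'x) trm \<Rightarrow> bool" where
  "true_at L A \<alpha> M \<longleftrightarrow> holds A (eval L A \<alpha> [] M)"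

fun clause_true_at :: "('c, 'x) lang \<Rightarrow> ('c, 'v) struct \<Rightarrow> ('x \<Rightarrow> 'v) \<Rightarrow> ('c, 'x) clause \<Rightarrow> bool" where
  "clause_true_at L A \<alpha> (Goal G) \<longleftrightarrow> (\<exists>M\<in>#G. \<not> true_at L A \<alpha> M)"
| "clause_true_at L A \<alpha> (Definite G R xs) \<longleftrightarrow>
     (\<exists>M\<in>#G. \<not> true_at L A \<alpha> M) \<or> true_at L A \<alpha> (apps (Sym R) (map Free xs))"

definition models :: "('c, 'x) lang \<Rightarrow> ('c, 'v) struct \<Rightarrow> ('c, 'x) clause \<Rightarrow> bool" where
  "models L A C \<longleftrightarrow> (\<forall>\<alpha>. valuation L A \<alpha> \<longrightarrow> clause_true_at L A \<alpha> C)"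

definition satisfiable :: "('c, 'x) lang \<Rightarrow> ('c, 'v) struct set \<Rightarrow> ('c, 'x) clause set \<Rightarrow> bool" where
  "satisfiable L \<AA> \<Gamma> \<longleftrightarrow> (\<exists>A\<in>\<AA>. \<exists>B. expansion L A B \<and> (\<forall>C\<in>\<Gamma>. models L B C))"

definition compact_structures :: "('c, 'x) lang \<Rightarrow> ('c, 'v) struct set \<Rightarrow> bool" where
  "compact_structures L \<AA> \<longleftrightarrow>
     (\<forall>S. (\<forall>C\<in>S. background_goal L C) \<and> \<not> satisfiable L \<AA> S \<longrightarrow>
        (\<exists>S'\<subseteq>S. finite S' \<and> \<not> satisfiable L \<AA> S'))"

text \<open>Both substitutions are only used with terms that have no dangling indices, so no lifting is
  needed.\<close>

fun subst :: "('x \<Rightarrow> ('c, 'x) trm) \<Rightarrow> ('c, 'x) trm \<Rightarrow> ('c, 'x) trm" where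
  "subst s (Free x) = s x"
| "subst s (App M N) = App (subst s M) (subst s N)"
| "subst s (Lam \<tau> M) = Lam \<tau> (subst s M)"
| "subst s M = M"

fun open_at :: "nat \<Rightarrow> ('c, 'x) trm \<Rightarrow> ('c, 'x) trm \<Rightarrow> ('c, 'x) trm" where
  "open_at k N (Bound i) = (if i = k then N else Bound i)"
| "open_at k N (App M M') = App (open_at k N M) (open_at k N M')"
| "open_at k N (Lam \<tau> M) = Lam \<tau> (open_at (Suc k) N M)"
| "open_at k N M = M"

definition inst :: "'x list \<Rightarrow> ('c, 'x) trm list \<Rightarrow> 'x \<Rightarrow> ('c, 'x) trm" where
  "inst xs Ms x = (case map_of (zip xs Ms) x of Some M \<Rightarrow> M | None \<Rightarrow> Free x)"

definition variants :: "('c, 'x) lang \<Rightarrow> ('c, 'x) clause set \<Rightarrow> ('c, 'x) clause set" where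
  "variants L \<Gamma> =
     {map_clause id \<pi> C | \<pi> C. C \<in> \<Gamma> \<and> bij \<pi> \<and> (\<forall>x. vty L (\<pi> x) = vty L x)}"

inductive derivable :: "('c, 'x) lang \<Rightarrow> ('c, 'v) struct set \<Rightarrow> ('c, 'x) clause set
    \<Rightarrow> ('c, 'x) clause \<Rightarrow> bool"
  for L :: "('c, 'x) lang" and \<AA> :: "('c, 'v) struct set" and \<Gamma> :: "('c, 'x) clause set"
  where
  resolution:
    "\<lbrakk> Goal (add_mset (apps (Sym R) Ms) G) \<in> variants L \<Gamma>;
       Definite G' R xs \<in> variants L \<Gamma>; length Ms = length xs \<rbrakk>
     \<Longrightarrow> derivable L \<AA> \<Gamma> (Goal (G + image_mset (subst (inst xs Ms)) G'))"
| beta: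
    "Goal (add_mset (apps (App (Lam \<tau> K) M) Ns) G) \<in> variants L \<Gamma>
     \<Longrightarrow> derivable L \<AA> \<Gamma> (Goal (add_mset (apps (open_at 0 M K) Ns) G))"
| constraint_refutation:
    "\<lbrakk> \<And>j. j < (n::nat) \<Longrightarrow> Goal (G j + \<Phi> j) \<in> variants L \<Gamma>;
       \<And>j A. j < n \<Longrightarrow> A \<in># G j \<Longrightarrow> \<exists>x Ms. A = apps (Free x) Ms;
       \<And>j A. j < n \<Longrightarrow> A \<in># \<Phi> j \<Longrightarrow> background_atom L A;
       \<not> satisfiable L \<AA> {Goal (\<Phi> j) | j. j < n} \<rbrakk>
     \<Longrightarrow> derivable L \<AA> \<Gamma> Bottom"

definition step :: "('c, 'x) lang \<Rightarrow> ('c, 'v) struct set \<Rightarrow> ('c, 'x) clause set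
    \<Rightarrow> ('c, 'x) clause set \<Rightarrow> bool" where
  "step L \<AA> \<Gamma> \<Gamma>' \<longleftrightarrow> (\<exists>C. derivable L \<AA> \<Gamma> C \<and> \<Gamma>' = \<Gamma> \<union> {C})"

end

theory Submission imports Defs "HOL-Combinatorics.Transposition" begin

text \<open>Completeness needs no fixed point construction. If \<open>\<bottom>\<close> is not derivable, compactness gives a
  structure that satisfies the background part of every derivable goal clause whose other atoms have a
  variable at the head. Over this structure, call an atom provable if it can be reduced backwards by
  \<open>\<beta>\<close>-steps and definite clauses to true background atoms and atoms with a variable at the head. Let
  a logical relation between values and terms relate a truth value \<open>b\<close> to \<open>M\<close> if \<open>b\<close> implies that
  \<open>M\<close> is provable, and an individual to the terms denoting it. Interpret \<open>R\<close> as true of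
  \<open>d\<^sub>1, \<dots>, d\<^sub>n\<close> if \<open>R M\<^sub>1 \<dots> M\<^sub>n\<close> is provable for all terms \<open>M\<^sub>i\<close> related to the \<open>d\<^sub>i\<close>. The
  fundamental lemma of the logical relation says that true atoms are provable. Hence the definite
  clauses hold. A goal clause that fails would have all its atoms provable, and lifting this proof
  (renaming clauses apart) yields a derivable goal clause whose background part fails.\<close>

section \<open>Typing and substitution\<close>

lemma usable_eq_Some [simp]: "usable L \<sigma> = Some \<tau> \<longleftrightarrow> \<sigma> \<in> tys L \<and> \<tau> = \<sigma>"
  by (auto simp: usable_def)

lemma ty_of_App [simp]:
  "ty_of L Ts (App M N) = Some \<tau> \<longleftrightarrow>
     (\<exists>\<sigma>. ty_of L Ts M = Some (Arr \<sigma> \<tau>) \<and> ty_of L Ts N = Some \<sigma>)"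
  by (auto split: option.splits ty.splits)

lemma ty_of_Lam [simp]:
  "ty_of L Ts (Lam \<tau> M) = Some \<upsilon> \<longleftrightarrow>
     (\<exists>\<rho>. ty_of L (\<tau> # Ts) M = Some \<rho> \<and> argument_type \<tau> \<and> relational \<rho> \<and>
        Arr \<tau> \<rho> \<in> tys L \<and> \<upsilon> = Arr \<tau> \<rho>)"
  by (auto split: option.splits)

declare ty_of.simps(8,9) [simp del]

lemma ty_of_append:
  "ty_of L Ts M = Some \<tau> \<Longrightarrow> ty_of L (Ts @ Us) M = Some \<tau>"
proof (induction M arbitrary: Ts \<tau>)
  case (Lam \<sigma> M)
  then show ?case using Lam.IH[of "\<sigma> # Ts"] by auto
qed (auto simp: nth_append split: if_splits)

lemma ty_of_apps:
  "ty_of L Ts (apps M Ns) = Some \<tau> \<longleftrightarrow>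
     (\<exists>Us. ty_of L Ts M = Some (foldr Arr Us \<tau>) \<and> map (ty_of L Ts) Ns = map Some Us)"
proof (induction Ns arbitrary: M)
  case (Cons N Ns)
  show ?case
  proof
    assume "ty_of L Ts (apps M (N # Ns)) = Some \<tau>"
    then obtain Us \<sigma> where "ty_of L Ts M = Some (Arr \<sigma> (foldr Arr Us \<tau>))"
      "ty_of L Ts N = Some \<sigma>" "map (ty_of L Ts) Ns = map Some Us"
      using Cons by auto
    then show "\<exists>Us. ty_of L Ts M = Some (foldr Arr Us \<tau>) \<and>
        map (ty_of L Ts) (N # Ns) = map Some Us"
      by (intro exI[of _ "\<sigma> # Us"]) auto
  qed (use Cons in auto)
qed simp

lemma foldr_Arr_inject:
  "length Us = length Vs \<Longrightarrow> foldr Arr Us \<sigma> = foldr Arr Vs \<tau> \<Longrightarrow> Us = Vs \<and> \<sigma> = \<tau>"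
  by (induction Us Vs rule: list_induct2) auto

text \<open>Local closure. \<open>lc_at 0\<close> is what makes a term safe to substitute under
  binders without lifting.\<close>

fun lc_at :: "nat \<Rightarrow> ('c, 'x) trm \<Rightarrow> bool" where
  "lc_at k (Bound i) \<longleftrightarrow> i < k"
| "lc_at k (App M N) \<longleftrightarrow> lc_at k M \<and> lc_at k N"
| "lc_at k (Lam \<tau> M) \<longleftrightarrow> lc_at (Suc k) M"
| "lc_at k M \<longleftrightarrow> True"

lemma lc_at_mono: "lc_at k M \<Longrightarrow> k \<le> i \<Longrightarrow> lc_at i M"
  by (induction k M arbitrary: i rule: lc_at.induct) auto

lemma lc_at_ty_of: "ty_of L Ts M = Some \<tau> \<Longrightarrow> lc_at (length Ts) M"
proof (induction M arbitrary: Ts \<tau>)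
  case (Lam \<sigma> M)
  then show ?case using Lam.IH[of "\<sigma> # Ts"] by auto
qed (auto split: if_splits)

lemma open_at_lc: "lc_at k M \<Longrightarrow> k \<le> i \<Longrightarrow> open_at i N M = M"
  by (induction k M arbitrary: i rule: lc_at.induct) auto

lemma lc_at_apps [simp]: "lc_at k (apps M Ns) \<longleftrightarrow> lc_at k M \<and> (\<forall>N\<in>set Ns. lc_at k N)"
  by (induction Ns arbitrary: M) auto

text \<open>Unlike \<open>subst\<close>, the following two substitutions may change the type of variable names.
  \<open>psub\<close> also replaces the dangling indices \<open>k, k + 1, \<dots>\<close>, so that it subsumes \<open>open_at\<close>.\<close>

primrec hsub :: "('x \<Rightarrow> ('c, 'y) trm) \<Rightarrow> ('c, 'x) trm \<Rightarrow> ('c, 'y) trm" where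
  "hsub s (Bound i) = Bound i"
| "hsub s (Free x) = s x"
| "hsub s (Sym c) = Sym c"
| "hsub s Neg = Neg"
| "hsub s Conj = Conj"
| "hsub s Disj = Disj"
| "hsub s (Exi \<tau>) = Exi \<tau>"
| "hsub s (App M N) = App (hsub s M) (hsub s N)"
| "hsub s (Lam \<tau> M) = Lam \<tau> (hsub s M)"

primrec psub :: "('x \<Rightarrow> ('c, 'y) trm) \<Rightarrow> nat \<Rightarrow> ('c, 'y) trm list \<Rightarrow> ('c, 'x) trm \<Rightarrow> ('c, 'y) trm"
  where
  "psub s k Ns (Bound i) = (if k \<le> i \<and> i - k < length Ns then Ns ! (i - k) else Bound i)"
| "psub s k Ns (Free x) = s x"
| "psub s k Ns (Sym c) = Sym c"
| "psub s k Ns Neg = Neg"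
| "psub s k Ns Conj = Conj"
| "psub s k Ns Disj = Disj"
| "psub s k Ns (Exi \<tau>) = Exi \<tau>"
| "psub s k Ns (App M N) = App (psub s k Ns M) (psub s k Ns N)"
| "psub s k Ns (Lam \<tau> M) = Lam \<tau> (psub s (Suc k) Ns M)"

lemma psub_Nil: "psub s k [] M = hsub s M"
  by (induction M arbitrary: k) auto

lemma subst_eq_hsub: "subst s M = hsub s M"
  by (induction M) auto

lemma subst_eq_psub: "subst s M = psub s 0 [] M"
  by (simp add: subst_eq_hsub psub_Nil)

lemma open_at_eq_psub: "open_at k N M = psub Free k [N] M"
  by (induction M arbitrary: k) auto

lemma map_trm_eq_hsub: "map_trm id \<pi> M = hsub (\<lambda>x. Free (\<pi> x)) M"
  by (induction M) auto

lemma hsub_hsub: "hsub s (hsub t M) = hsub (\<lambda>x. hsub s (t x)) M"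
  by (induction M) auto

lemma hsub_cong: "(\<And>x. x \<in> set2_trm M \<Longrightarrow> s x = t x) \<Longrightarrow> hsub s M = hsub t M"
  by (induction M) auto

lemma hsub_apps [simp]: "hsub s (apps M Ns) = apps (hsub s M) (map (hsub s) Ns)"
  by (induction Ns arbitrary: M) auto

lemma map_trm_apps [simp]:
  "map_trm f g (apps M Ns) = apps (map_trm f g M) (map (map_trm f g) Ns)"
  by (induction Ns arbitrary: M) auto

lemma hsub_open_at:
  assumes "\<And>x. lc_at 0 (s x)"
  shows "hsub s (open_at k N M) = open_at k (hsub s N) (hsub s M)"
  by (induction M arbitrary: k) (auto simp: open_at_lc[OF assms])

text \<open>\<open>psub s (Suc k)\<close> leaves index \<open>k\<close> for the argument of a redex;
  contracting the redex just prepends that argument to the list.\<close>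

lemma open_at_psub:
  assumes "\<And>x. lc_at 0 (s x)" and "\<And>N. N \<in> set Ns \<Longrightarrow> lc_at 0 N"
  shows "open_at k N (psub s (Suc k) Ns M) = psub s k (N # Ns) M"
proof (induction M arbitrary: k)
  case (Bound i)
  show ?case
    by (cases "i \<le> k") (auto simp: Suc_le_eq nth_Cons' intro!: open_at_lc[of 0] assms)
qed (auto simp: open_at_lc[OF assms(1)])

lemma lc_at_psub:
  assumes "\<And>x. lc_at 0 (s x)" and "\<And>N. N \<in> set Ns \<Longrightarrow> lc_at 0 N"
  shows "lc_at (k + length Ns) M \<Longrightarrow> lc_at k (psub s k Ns M)"
  by (induction M arbitrary: k) (auto intro: assms lc_at_mono[OF assms(1)] lc_at_mono[OF assms(2)])

section \<open>Preservation of logic-freeness, types and values by substitution\<close>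

lemma logic_free_psub:
  assumes "\<And>x. logic_free (s x)" and "\<And>N. N \<in> set Ns \<Longrightarrow> logic_free N"
  shows "logic_free M \<Longrightarrow> logic_free (psub s k Ns M)"
  by (induction M arbitrary: k) (auto intro: assms)

lemma logic_free_apps [simp]:
  "logic_free (apps M Ns) \<longleftrightarrow> logic_free M \<and> (\<forall>N\<in>set Ns. logic_free N)"
  by (induction Ns arbitrary: M) auto

text \<open>The replacements are typed in the empty context, so weakening inserts them under any
  binders. A variable whose type is outside \<open>tys L\<close> is untypable and cannot occur in
  \<open>M\<close>.\<close>

lemma ty_of_psub:
  assumes s: "\<And>x. vty L x \<in> tys L \<Longrightarrow> ty_of L [] (s x) = Some (vty L x)"
    and Ns: "map (ty_of L []) Ns = map Some Us"
  shows "ty_of L (Ts @ Us) M = Some \<tau> \<Longrightarrow> ty_of L Ts (psub s (length Ts) Ns M) = Some \<tau>"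
proof (induction M arbitrary: Ts \<tau>)
  case (Bound i)
  have len: "length Ns = length Us"
    using Ns by (metis length_map)
  have "ty_of L [] (Ns ! j) = Some (Us ! j)" if "j < length Us" for j
    using Ns that len by (metis nth_map)
  then show ?case
    using Bound len ty_of_append[of L "[]" _ _ Ts] by (auto simp: nth_append split: if_splits)
next
  case (Free x)
  then show ?case using s ty_of_append[of L "[]" _ _ Ts] by auto
next
  case (Lam \<sigma> M)
  then show ?case using Lam.IH[of "\<sigma> # Ts"] by auto
qed (auto split: if_splits)

text \<open>Typing confines the dangling indices to \<open>e\<close>. It also fixes the types of the
  bodies of abstractions, which \<open>eval\<close> reads off the context.\<close>

lemma eval_append:
  "ty_of L (map fst e) M = Some \<tau> \<Longrightarrow> eval L A \<alpha> (e @ e') M = eval L A \<alpha> e M"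
proof (induction M arbitrary: e \<tau>)
  case (Lam \<sigma> M)
  then obtain \<rho> where "ty_of L (\<sigma> # map fst e) M = Some \<rho>"
    by auto
  then show ?case
    using Lam.IH[of "(\<sigma>, _) # e"] ty_of_append[of L "\<sigma> # map fst e" M \<rho> "map fst e'"] by simp
qed (auto simp: nth_append split: if_splits)

text \<open>The substitution lemma, in a form that yields both the semantics of \<open>subst\<close>
  (\<open>Ns = []\<close>) and that of \<open>open_at\<close> (\<open>s = Free\<close>).\<close>

lemma eval_psub:
  assumes s: "\<And>x. vty L x \<in> tys L \<Longrightarrow> ty_of L [] (s x) = Some (vty L x)"
    and Ns: "map (ty_of L []) Ns = map Some Us"
  shows "ty_of L (map fst e @ Us) M = Some \<tau> \<Longrightarrow>
    eval L A \<alpha> e (psub s (length e) Ns M) =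
    eval L A (\<lambda>x. eval L A \<alpha> [] (s x)) (e @ zip Us (map (eval L A \<alpha> []) Ns)) M"
proof (induction M arbitrary: e \<tau>)
  case (Bound i)
  have len: "length Ns = length Us"
    using Ns by (metis length_map)
  have "ty_of L [] (Ns ! j) = Some (Us ! j)" if "j < length Us" for j
    using Ns that len by (metis nth_map)
  then show ?case
    using Bound len eval_append[of L "[]" _ _ A \<alpha> e] by (auto simp: nth_append split: if_splits)
next
  case (Free x)
  then show ?case
    using s eval_append[of L "[]" _ _ A \<alpha> e] by auto
next
  case (Lam \<sigma> M)
  have len: "length Us = length Ns"
    using Ns by (metis length_map)
  obtain \<rho> where \<rho>: "ty_of L (\<sigma> # map fst e @ Us) M = Some \<rho>"
    using Lam.prems by auto
  \<comment> \<open>\<open>eval\<close> picks the code of an abstraction by the type of its body, so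
    this type must survive the substitution.\<close>
  have "ty_of L (\<sigma> # map fst e) (psub s (Suc (length e)) Ns M) = Some \<rho>"
    using ty_of_psub[OF s Ns, of "\<sigma> # map fst e" M \<rho>] \<rho> by simp
  then show ?case
    using Lam.IH[of "(\<sigma>, _) # e"] \<rho> len by simp
qed (auto split: if_splits)

lemma ty_of_map_trm:
  assumes "\<And>x. vty L (\<pi> x) = vty L x"
  shows "ty_of L Ts (map_trm id \<pi> M) = ty_of L Ts M"
  by (induction M arbitrary: Ts)
     (auto simp: assms ty_of.simps(8,9) cong: option.case_cong ty.case_cong)

lemma eval_map_trm:
  assumes "\<And>x. vty L (\<pi> x) = vty L x"
  shows "eval L A \<alpha> e (map_trm id \<pi> M) = eval L A (\<lambda>x. \<alpha> (\<pi> x)) e M"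
  by (induction M arbitrary: e) (auto simp: ty_of_map_trm[of L, OF assms])

lemma logic_free_map_trm [simp]: "logic_free (map_trm f \<pi> M) = logic_free M"
  by (induction M) auto

section \<open>Derived clauses are Horn clauses\<close>

text \<open>\<open>Ms\<close> and \<open>xs\<close> are argument lists of equal length for one head
  \<open>H\<close>, whose type dictates the same argument types for both.\<close>

lemma ty_of_inst:
  assumes "ty_of L [] (apps H Ms) = Some \<sigma>" and "ty_of L [] (apps H (map Free xs)) = Some \<tau>"
    and "length Ms = length xs" and "vty L x \<in> tys L"
  shows "ty_of L [] (inst xs Ms x) = Some (vty L x)"
proof -
  obtain Us where Us: "ty_of L [] H = Some (foldr Arr Us \<sigma>)" "map (ty_of L []) Ms = map Some Us"
    using assms(1) unfolding ty_of_apps by auto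
  obtain Vs where Vs: "ty_of L [] H = Some (foldr Arr Vs \<tau>)"
    "map (ty_of L []) (map Free xs) = map Some Vs"
    using assms(2) unfolding ty_of_apps by auto
  have "length Us = length Ms" "length Vs = length xs"
    using Us(2) Vs(2) by (metis length_map)+
  then have "Us = Vs"
    using Us(1) Vs(1) assms(3) foldr_Arr_inject[of Us Vs \<sigma> \<tau>] by simp
  then have eq: "map (ty_of L []) Ms = map (\<lambda>x. usable L (vty L x)) xs"
    using Us Vs by (simp add: comp_def)
  have "ty_of L [] M = usable L (vty L x)" if "map_of (zip xs Ms) x = Some M" for M
  proof -
    have "(x, M) \<in> set (zip xs Ms)"
      using that by (rule map_of_SomeD)
    then obtain i where "i < length xs" "xs ! i = x" "Ms ! i = M"
      by (auto simp: set_zip)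
    then show ?thesis
      using eq assms(3) by (metis nth_map)
  qed
  then show ?thesis
    using assms(4) by (auto simp: inst_def split: option.splits)
qed

lemma logic_free_inst:
  assumes "\<And>M. M \<in> set Ms \<Longrightarrow> logic_free M"
  shows "logic_free (inst xs Ms x)"
  using assms by (auto simp: inst_def split: option.splits dest!: map_of_SomeD set_zip_rightD)

lemma atom_map_trm:
  assumes "\<And>x. vty L (\<pi> x) = vty L x"
  shows "atom L (map_trm id \<pi> M) = atom L M"
  by (simp add: atom_def formula_def ty_of_map_trm[of L, OF assms])

lemma variants_self: "C \<in> \<Delta> \<Longrightarrow> C \<in> variants L \<Delta>"
  unfolding variants_def
  by (rule CollectI, rule exI[of _ id], rule exI[of _ C]) (auto simp: clause.map_id)

lemma hochc_variants:
  assumes "\<forall>C\<in>\<Gamma>. hochc L C" and "C \<in> variants L \<Gamma>"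
  shows "hochc L C"
proof -
  obtain \<pi> D where D: "C = map_clause id \<pi> D" "D \<in> \<Gamma>" "bij \<pi>" "\<And>x. vty L (\<pi> x) = vty L x"
    using assms(2) by (auto simp: variants_def)
  have "hochc L D"
    using assms(1) D(2) by blast
  then show ?thesis
  proof (cases D)
    case (Definite G R xs)
    have "apps (Sym R) (map Free (map \<pi> xs)) =
        (map_trm id \<pi> (apps (Sym R) (map Free xs)) :: ('a, 'b) trm)"
      by (simp add: comp_def)
    then show ?thesis
      using \<open>hochc L D\<close> Definite D(3) unfolding D(1)
      by (auto simp: atom_map_trm[of L, OF D(4)] formula_def ty_of_map_trm[of L, OF D(4)]
          distinct_map bij_def simp del: map_trm_apps map_map intro: inj_on_subset)
  qed (auto simp: D(1) atom_map_trm[of L, OF D(4)])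
qed

lemma atom_subst_inst:
  assumes "atom L (apps (Sym R) Ms)" and "formula L (apps (Sym R) (map Free xs))"
    and "length Ms = length xs" and "atom L A"
  shows "atom L (subst (inst xs Ms) A)"
  unfolding atom_def formula_def
proof
  show "ty_of L [] (subst (inst xs Ms) A) = Some Prop"
    using ty_of_psub[of L "inst xs Ms" "[]" "[]" "[]" A Prop] assms
      ty_of_inst[of L "Sym R" Ms Prop xs Prop]
    by (simp add: subst_eq_psub atom_def formula_def)
  show "logic_free (subst (inst xs Ms) A)"
    unfolding subst_eq_psub
    by (intro logic_free_psub logic_free_inst) (use assms in \<open>auto simp: atom_def\<close>)
qed

lemma ty_of_open_at:
  assumes "ty_of L [] (App (Lam \<sigma> K) M) = Some \<tau>"
  shows "ty_of L [] (open_at 0 M K) = Some \<tau>"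
  using ty_of_psub[of L Free "[M]" "[\<sigma>]" "[]" K \<tau>] assms by (auto simp: open_at_eq_psub)

lemma atom_beta:
  assumes "atom L (apps (App (Lam \<sigma> K) M) Ns)"
  shows "atom L (apps (open_at 0 M K) Ns)"
proof -
  have "logic_free (open_at 0 M K)"
    unfolding open_at_eq_psub by (rule logic_free_psub) (use assms in \<open>auto simp: atom_def\<close>)
  then show ?thesis
    using assms ty_of_open_at[of L \<sigma> K M] by (auto simp: atom_def formula_def ty_of_apps
        simp del: ty_of_App)
qed

lemma hochc_derivable:
  assumes "derivable L \<AA> \<Gamma> C" and "\<forall>C\<in>\<Gamma>. hochc L C"
  shows "hochc L C"
  using assms(1)
proof cases
  case (resolution R Ms G G' xs)
  then show ?thesis
    using hochc_variants[OF assms(2) resolution(2)] hochc_variants[OF assms(2) resolution(3)]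
    by (auto intro: atom_subst_inst)
next
  case (beta \<tau> K M Ns G)
  then show ?thesis
    using hochc_variants[OF assms(2) beta(2)] by (auto intro: atom_beta)
qed simp

lemma hochc_steps:
  assumes "(step L \<AA>)\<^sup>*\<^sup>* \<Gamma> \<Delta>" and "\<forall>C\<in>\<Gamma>. hochc L C"
  shows "\<forall>C\<in>\<Delta>. hochc L C"
  using assms by induction (auto simp: step_def dest: hochc_derivable)

section \<open>Standard structures\<close>

text \<open>Codes the curried form of a predicate on argument lists. Relational types end in
  \<open>Prop\<close>, so the value at \<open>Ind\<close> is a mere default.\<close>

primrec pred_code :: "('c, 'v) struct \<Rightarrow> ty \<Rightarrow> ('v list \<Rightarrow> bool) \<Rightarrow> 'v" where
  "pred_code A Ind P = truth A (P [])"
| "pred_code A Prop P = truth A (P [])"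
| "pred_code A (Arr \<sigma> \<tau>) P = fn_code A \<sigma> \<tau> (\<lambda>d. pred_code A \<tau> (\<lambda>ds. P (d # ds)))"

lemma language_Arr: "language L \<Longrightarrow> Arr \<sigma> \<tau> \<in> tys L \<Longrightarrow> \<sigma> \<in> tys L \<and> \<tau> \<in> tys L"
  unfolding language_def by blast

lemma language_cty: "language L \<Longrightarrow> c \<in> sig L \<Longrightarrow> cty L c \<in> tys L"
  unfolding language_def by blast

lemma ty_of_in_tys:
  assumes "language L"
  shows "ty_of L Ts M = Some \<tau> \<Longrightarrow> set Ts \<subseteq> tys L \<Longrightarrow> \<tau> \<in> tys L"
proof (induction M arbitrary: Ts \<tau>)
  case (Sym c)
  then show ?case using language_cty[OF assms] by (auto split: if_splits)
next
  case (App M N)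
  then obtain \<sigma> where "ty_of L Ts M = Some (Arr \<sigma> \<tau>)"
    by auto
  then show ?case
    using App.IH(1) App.prems(2) language_Arr[OF assms] by blast
qed (auto split: if_splits)

lemma eval_apps:
  "eval L A \<alpha> e (apps M Ns) = foldl (app A) (eval L A \<alpha> e M) (map (eval L A \<alpha> e) Ns)"
  by (induction Ns arbitrary: M) auto

lemma eval_first_order_cong:
  assumes "\<And>x. vty L x = Ind \<Longrightarrow> \<alpha> x = \<beta> x"
  shows "first_order L M \<Longrightarrow> eval L A \<alpha> e M = eval L A \<beta> e M"
  by (induction M) (auto intro: assms)

locale standard_frame =
  fixes L :: "('c, 'x) lang" and A :: "('c, 'v) struct"
  assumes language: "language L" and standard: "standard L A"
begin

lemma argument_type_vty: "argument_type (vty L x)"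
  using language by (simp add: language_def)

text \<open>Agreement on the domain is equality of restrictions, so surjectivity of the coding in
  \<open>standard\<close> gives existence and injectivity gives uniqueness.\<close>

lemma ex1_fn_code:
  assumes "Arr \<sigma> \<tau> \<in> tys L" and "\<And>v. v \<in> Dom A \<sigma> \<Longrightarrow> g v \<in> Dom A \<tau>"
  shows "\<exists>!f. f \<in> Dom A (Arr \<sigma> \<tau>) \<and> (\<forall>v\<in>Dom A \<sigma>. app A f v = g v)"
proof -
  have bij: "bij_betw (\<lambda>f. restrict (app A f) (Dom A \<sigma>)) (Dom A (Arr \<sigma> \<tau>))
      (Dom A \<sigma> \<rightarrow>\<^sub>E Dom A \<tau>)"
    using standard assms(1) by (auto simp: standard_def)
  have eq: "(\<forall>v\<in>Dom A \<sigma>. app A f v = g v) \<longleftrightarrow>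
      restrict (app A f) (Dom A \<sigma>) = restrict g (Dom A \<sigma>)" for f
    by (auto simp: restrict_def fun_eq_iff)
  have "restrict g (Dom A \<sigma>) \<in> Dom A \<sigma> \<rightarrow>\<^sub>E Dom A \<tau>"
    using assms(2) by auto
  then have "restrict g (Dom A \<sigma>) \<in> (\<lambda>f. restrict (app A f) (Dom A \<sigma>)) ` Dom A (Arr \<sigma> \<tau>)"
    using bij_betw_imp_surj_on[OF bij] by simp
  then show ?thesis
    unfolding eq using inj_onD[OF bij_betw_imp_inj_on[OF bij]] by (elim imageE) (intro ex1I, auto)
qed

lemma
  assumes "Arr \<sigma> \<tau> \<in> tys L" and "\<And>v. v \<in> Dom A \<sigma> \<Longrightarrow> g v \<in> Dom A \<tau>"
  shows fn_code_in_Dom: "fn_code A \<sigma> \<tau> g \<in> Dom A (Arr \<sigma> \<tau>)"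
    and app_fn_code: "v \<in> Dom A \<sigma> \<Longrightarrow> app A (fn_code A \<sigma> \<tau> g) v = g v"
  using theI'[OF ex1_fn_code[of \<sigma> \<tau> g, OF assms]] by (auto simp: fn_code_def)

lemma app_in_Dom:
  assumes "Arr \<sigma> \<tau> \<in> tys L" and "f \<in> Dom A (Arr \<sigma> \<tau>)" and "v \<in> Dom A \<sigma>"
  shows "app A f v \<in> Dom A \<tau>"
proof -
  have "restrict (app A f) (Dom A \<sigma>) \<in> Dom A \<sigma> \<rightarrow>\<^sub>E Dom A \<tau>"
    using standard assms(1,2) unfolding standard_def by (metis (no_types, lifting) bij_betwE)
  then show ?thesis
    using assms(3) by (auto simp: PiE_iff)
qed

lemma truth_in_Dom: "truth A b \<in> Dom A Prop"
  using standard by (auto simp: standard_def)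

lemma holds_truth [simp]: "holds A (truth A b) \<longleftrightarrow> b"
  using standard by (auto simp: standard_def holds_def inj_def)

lemma pred_code_in_Dom:
  "relational \<rho> \<Longrightarrow> \<rho> \<in> tys L \<Longrightarrow> pred_code A \<rho> P \<in> Dom A \<rho>"
proof (induction \<rho> arbitrary: P)
  case (Arr \<sigma> \<tau>)
  then show ?case
    using language_Arr[OF language Arr.prems(2)] by (auto intro: fn_code_in_Dom)
qed (auto intro: truth_in_Dom)

lemma app_pred_code:
  assumes "relational (Arr \<sigma> \<tau>)" and "Arr \<sigma> \<tau> \<in> tys L" and "d \<in> Dom A \<sigma>"
  shows "app A (pred_code A (Arr \<sigma> \<tau>) P) d = pred_code A \<tau> (\<lambda>ds. P (d # ds))"
  using assms language_Arr[OF language assms(2)] by (auto simp: app_fn_code pred_code_in_Dom)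

lemma foldl_app_pred_code:
  "relational (foldr Arr Us Prop) \<Longrightarrow> foldr Arr Us Prop \<in> tys L \<Longrightarrow>
   list_all2 (\<lambda>d U. d \<in> Dom A U) ds Us \<Longrightarrow>
   foldl (app A) (pred_code A (foldr Arr Us Prop) P) ds = truth A (P ds)"
proof (induction Us arbitrary: ds P)
  case (Cons U Us)
  then obtain d ds' where ds: "ds = d # ds'" "d \<in> Dom A U"
    "list_all2 (\<lambda>d U. d \<in> Dom A U) ds' Us"
    by (auto simp: list_all2_Cons2)
  have "app A (pred_code A (foldr Arr (U # Us) Prop) P) d =
      pred_code A (foldr Arr Us Prop) (\<lambda>ds. P (d # ds))"
    using app_pred_code[of U "foldr Arr Us Prop" d P] Cons.prems ds by simp
  then show ?case
    using Cons.IH[of ds' "\<lambda>ds. P (d # ds)"] Cons.prems ds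
      language_Arr[OF language, of U "foldr Arr Us Prop"] by simp
qed simp

lemma Dom_nonempty:
  assumes "argument_type \<tau>" and "\<tau> \<in> tys L"
  shows "\<exists>v. v \<in> Dom A \<tau>"
  using assms standard pred_code_in_Dom[of \<tau>] by (auto simp: argument_type_def standard_def)

text \<open>Ensures that \<open>Bottom\<close> is not vacuously true in a structure.\<close>

lemma ex_valuation: "\<exists>\<alpha>. valuation L A \<alpha>"
proof -
  have "\<forall>x. \<exists>v. vty L x \<in> tys L \<longrightarrow> v \<in> Dom A (vty L x)"
    using Dom_nonempty argument_type_vty by blast
  then show ?thesis
    unfolding valuation_def by (rule choice)
qed

lemma eval_in_Dom:
  assumes itp: "\<And>c. c \<in> sig L \<Longrightarrow> itp A c \<in> Dom A (cty L c)" and "valuation L A \<alpha>"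
  shows "logic_free M \<Longrightarrow> ty_of L (map fst e) M = Some \<tau> \<Longrightarrow>
    (\<And>\<sigma> v. (\<sigma>, v) \<in> set e \<Longrightarrow> \<sigma> \<in> tys L \<and> v \<in> Dom A \<sigma>) \<Longrightarrow> eval L A \<alpha> e M \<in> Dom A \<tau>"
proof (induction M arbitrary: e \<tau>)
  case (Bound i)
  then show ?case
    by (cases "e ! i") (auto split: if_splits dest!: nth_mem[of i e])
next
  case (Free x)
  then show ?case using assms(2) by (auto simp: valuation_def)
next
  case (App M N)
  then obtain \<sigma> where \<sigma>: "ty_of L (map fst e) M = Some (Arr \<sigma> \<tau>)"
    "ty_of L (map fst e) N = Some \<sigma>"
    by auto
  moreover have "Arr \<sigma> \<tau> \<in> tys L"
    using ty_of_in_tys[OF language \<sigma>(1)] App.prems(3) by fastforce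
  ultimately show ?case
    using App by (auto intro: app_in_Dom)
next
  case (Lam \<sigma> M)
  then obtain \<rho> where \<rho>: "ty_of L (\<sigma> # map fst e) M = Some \<rho>" "Arr \<sigma> \<rho> \<in> tys L" "\<tau> = Arr \<sigma> \<rho>"
    by auto
  have "eval L A \<alpha> ((\<sigma>, v) # e) M \<in> Dom A \<rho>" if "v \<in> Dom A \<sigma>" for v
    using Lam.IH[of "(\<sigma>, v) # e" \<rho>] Lam.prems \<rho> that language_Arr[OF language \<rho>(2)] by auto
  then show ?case
    using \<rho> by (auto intro: fn_code_in_Dom)
qed (auto split: if_splits intro: itp)

section \<open>Soundness\<close>

lemma models_variants:
  assumes "\<forall>C\<in>\<Gamma>. models L A C" and "C \<in> variants L \<Gamma>"
  shows "models L A C"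
  unfolding models_def
proof (intro allI impI)
  fix \<alpha> assume \<alpha>: "valuation L A \<alpha>"
  obtain \<pi> D where D: "C = map_clause id \<pi> D" "D \<in> \<Gamma>" and \<pi>: "\<And>x. vty L (\<pi> x) = vty L x"
    using assms(2) by (auto simp: variants_def)
  have "valuation L A (\<lambda>x. \<alpha> (\<pi> x))"
    using \<alpha> \<pi> by (metis valuation_def)
  then have D_true: "clause_true_at L A (\<lambda>x. \<alpha> (\<pi> x)) D"
    using assms(1) D(2) by (auto simp: models_def)
  show "clause_true_at L A \<alpha> C"
  proof (cases D)
    case (Definite G R xs)
    have "apps (Sym R) (map Free (map \<pi> xs)) =
        (map_trm id \<pi> (apps (Sym R) (map Free xs)) :: ('c, 'x) trm)"
      by (simp add: comp_def)
    then show ?thesis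
      using D_true unfolding D(1) Definite
      by (auto simp: true_at_def eval_map_trm[of L, OF \<pi>] simp del: map_trm_apps map_map)
  qed (use D_true in \<open>auto simp: D(1) true_at_def eval_map_trm[of L, OF \<pi>]\<close>)
qed

text \<open>Soundness of \<beta>-reduction: application undoes the coding of the abstraction because
  the logic-free body takes values in \<open>Dom A \<tau>\<close>; the substitution lemma does the
  rest.\<close>

lemma eval_open_at:
  assumes itp: "\<And>c. c \<in> sig L \<Longrightarrow> itp A c \<in> Dom A (cty L c)" and \<alpha>: "valuation L A \<alpha>"
    and "ty_of L [] (App (Lam \<sigma> K) M) = Some \<tau>" and "logic_free K" and "logic_free M"
  shows "eval L A \<alpha> [] (App (Lam \<sigma> K) M) = eval L A \<alpha> [] (open_at 0 M K)"
proof -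
  have K: "ty_of L [\<sigma>] K = Some \<tau>" and M: "ty_of L [] M = Some \<sigma>" and tys: "Arr \<sigma> \<tau> \<in> tys L"
    using assms(3) by auto
  have "eval L A \<alpha> [(\<sigma>, v)] K \<in> Dom A \<tau>" if "v \<in> Dom A \<sigma>" for v
    by (rule eval_in_Dom[OF itp \<alpha>])
       (use assms K that language_Arr[OF language tys] in auto)
  moreover have "eval L A \<alpha> [] M \<in> Dom A \<sigma>"
    by (rule eval_in_Dom[OF itp \<alpha>]) (use assms M in auto)
  ultimately have "eval L A \<alpha> [] (App (Lam \<sigma> K) M) = eval L A \<alpha> [(\<sigma>, eval L A \<alpha> [] M)] K"
    using K tys by (simp add: app_fn_code)
  then show ?thesis
    using eval_psub[of L Free "[M]" "[\<sigma>]" "[]" K \<tau> A \<alpha>] K M by (simp add: open_at_eq_psub)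
qed

text \<open>Setting all relational variables to the always true relation validates the atoms with a
  variable at the head and leaves the background atoms alone.\<close>

lemma models_background_part:
  assumes itp: "\<And>c. c \<in> sig L \<Longrightarrow> itp A c \<in> Dom A (cty L c)"
    and models: "models L A (Goal (G + \<Phi>))" and hochc: "hochc L (Goal (G + \<Phi>))"
    and G: "\<And>M. M \<in># G \<Longrightarrow> \<exists>x Ms. M = apps (Free x) Ms"
    and \<Phi>: "\<And>M. M \<in># \<Phi> \<Longrightarrow> background_atom L M"
  shows "models L A (Goal \<Phi>)"
  unfolding models_def
proof (intro allI impI)
  fix \<alpha> assume \<alpha>: "valuation L A \<alpha>"
  define \<beta> where "\<beta> x = (if vty L x = Ind then \<alpha> x else pred_code A (vty L x) (\<lambda>_. True))" for x
  have \<beta>: "valuation L A \<beta>"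
    using \<alpha> argument_type_vty unfolding valuation_def \<beta>_def argument_type_def
    by (metis pred_code_in_Dom)
  have "true_at L A \<beta> M" if "M \<in># G" for M
  proof -
    obtain x Ms where M: "M = apps (Free x) Ms"
      using G \<open>M \<in># G\<close> by blast
    have "atom L M"
      using hochc \<open>M \<in># G\<close> by auto
    then obtain Us where Us: "vty L x = foldr Arr Us Prop" "vty L x \<in> tys L"
      "map (ty_of L []) Ms = map Some Us"
      unfolding M atom_def formula_def ty_of_apps by (metis ty_of.simps(2) usable_eq_Some)
    have "list_all2 (\<lambda>d U. d \<in> Dom A U) (map (eval L A \<beta> []) Ms) Us"
      unfolding list_all2_conv_all_nth
    proof (intro conjI allI impI)
      show len: "length (map (eval L A \<beta> []) Ms) = length Us"
        using Us(3) by (metis length_map)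
      fix i assume i: "i < length (map (eval L A \<beta> []) Ms)"
      then have "ty_of L [] (Ms ! i) = Some (Us ! i)"
        using Us(3) len by (metis length_map nth_map)
      moreover have "logic_free (Ms ! i)"
        using \<open>atom L M\<close> i by (auto simp: M atom_def)
      ultimately show "map (eval L A \<beta> []) Ms ! i \<in> Dom A (Us ! i)"
        using i eval_in_Dom[OF itp \<beta>, where e = "[]"] by auto
    qed
    moreover have "vty L x \<noteq> Ind"
      using Us(1) by (cases Us) auto
    moreover from this have "relational (vty L x)"
      using argument_type_vty[of x] by (simp add: argument_type_def)
    ultimately show ?thesis
      using Us foldl_app_pred_code[of Us "map (eval L A \<beta> []) Ms" "\<lambda>_. True"]
      by (simp add: true_at_def M eval_apps \<beta>_def)
  qed
  then obtain M where M: "M \<in># \<Phi>" "\<not> true_at L A \<beta> M"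
    using models \<beta> by (auto simp: models_def)
  then have "\<not> true_at L A \<alpha> M"
    using \<Phi>[OF M(1)] eval_first_order_cong[of L \<alpha> \<beta> M A "[]"]
    by (auto simp: true_at_def background_atom_def \<beta>_def)
  then show "clause_true_at L A \<alpha> (Goal \<Phi>)"
    using M(1) by auto
qed

end

lemma map_inst: "distinct xs \<Longrightarrow> length Ms = length xs \<Longrightarrow> map (inst xs Ms) xs = Ms"
  by (rule nth_equalityI) (auto simp: inst_def map_of_zip_nth)

text \<open>Read the definite clause at the valuation giving each variable the value of its
  instance: its head then has the truth value of \<open>apps (Sym R) Ms\<close>, its body those of
  the instantiated atoms. So the premises cannot hold while the resolvent fails.\<close>

lemma (in standard_frame) models_resolvent:
  assumes itp: "\<And>c. c \<in> sig L \<Longrightarrow> itp A c \<in> Dom A (cty L c)"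
    and goal: "models L A (Goal (add_mset (apps (Sym R) Ms) G))"
      "hochc L (Goal (add_mset (apps (Sym R) Ms) G))"
    and def: "models L A (Definite G' R xs)" "hochc L (Definite G' R xs)"
    and len: "length Ms = length xs"
  shows "models L A (Goal (G + image_mset (subst (inst xs Ms)) G'))"
  unfolding models_def
proof (intro allI impI)
  fix \<alpha> assume \<alpha>: "valuation L A \<alpha>"
  define \<beta> where "\<beta> x = eval L A \<alpha> [] (inst xs Ms x)" for x
  have tyi: "ty_of L [] (inst xs Ms x) = Some (vty L x)" if "vty L x \<in> tys L" for x
    using ty_of_inst[of L "Sym R" Ms Prop xs Prop] goal(2) def(2) len that
    by (auto simp: atom_def formula_def)
  have "eval L A \<alpha> [] (inst xs Ms x) \<in> Dom A (vty L x)" if "vty L x \<in> tys L" for x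
    by (rule eval_in_Dom[OF itp \<alpha>])
       (use goal(2) tyi[OF that] in \<open>auto intro: logic_free_inst simp: atom_def\<close>)
  then have \<beta>: "valuation L A \<beta>"
    by (auto simp: valuation_def \<beta>_def)
  have eval_subst: "eval L A \<alpha> [] (subst (inst xs Ms) M) = eval L A \<beta> [] M" if "formula L M" for M
    using eval_psub[of L "inst xs Ms" "[]" "[]" "[]" M Prop A \<alpha>] tyi that
    by (simp add: subst_eq_psub formula_def \<beta>_def[abs_def])
  have "subst (inst xs Ms) (apps (Sym R) (map Free xs)) = apps (Sym R) Ms"
    using map_inst[of xs Ms] def(2) len by (simp add: subst_eq_hsub comp_def)
  then have head: "true_at L A \<beta> (apps (Sym R) (map Free xs)) = true_at L A \<alpha> (apps (Sym R) Ms)"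
    using eval_subst[of "apps (Sym R) (map Free xs)"] def(2) by (simp add: true_at_def)
  have body: "true_at L A \<alpha> (subst (inst xs Ms) M) = true_at L A \<beta> M" if "M \<in># G'" for M
    using eval_subst[of M] def(2) that by (simp add: true_at_def atom_def)
  have "clause_true_at L A \<alpha> (Goal (add_mset (apps (Sym R) Ms) G))"
    using goal(1) \<alpha> by (simp add: models_def)
  moreover have "clause_true_at L A \<beta> (Definite G' R xs)"
    using def(1) \<beta> by (simp add: models_def)
  ultimately show "clause_true_at L A \<alpha> (Goal (G + image_mset (subst (inst xs Ms)) G'))"
    using head body by auto
qed

lemma expansion_fo_structure:
  assumes "language L" and "fo_structure L A" and "expansion L A B"
  shows "standard_frame L B" and "c \<in> sig L \<Longrightarrow> itp B c \<in> Dom B (cty L c)"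
  using assms unfolding standard_frame_def fo_structure_def expansion_def standard_def by auto

lemma derivable_sound:
  assumes "language L" and \<AA>: "\<forall>A\<in>\<AA>. fo_structure L A"
    and B: "A \<in> \<AA>" "expansion L A B"
    and \<Gamma>: "\<forall>C\<in>\<Gamma>. hochc L C" "\<forall>C\<in>\<Gamma>. models L B C"
    and "derivable L \<AA> \<Gamma> C"
  shows "models L B C"
proof -
  interpret standard_frame L B
    using expansion_fo_structure(1)[OF assms(1) _ B(2)] \<AA> B(1) by blast
  have itp: "itp B c \<in> Dom B (cty L c)" if "c \<in> sig L" for c
    using expansion_fo_structure(2)[OF assms(1) _ B(2) that] \<AA> B(1) by blast
  note var = models_variants[OF \<Gamma>(2)] hochc_variants[OF \<Gamma>(1)]
  show ?thesis
    using \<open>derivable L \<AA> \<Gamma> C\<close>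
  proof cases
    case (resolution R Ms G G' xs)
    then show ?thesis
      using models_resolvent[OF itp var(1)[OF resolution(2)] var(2)[OF resolution(2)]
          var(1)[OF resolution(3)] var(2)[OF resolution(3)] resolution(4)] by simp
  next
    case (beta \<tau> K M Ns G)
    have at: "atom L (apps (App (Lam \<tau> K) M) Ns)"
      using var(2)[OF beta(2)] by simp
    have "eval L B \<alpha> [] (apps (App (Lam \<tau> K) M) Ns) = eval L B \<alpha> [] (apps (open_at 0 M K) Ns)"
      if "valuation L B \<alpha>" for \<alpha>
    proof -
      obtain \<sigma> where "ty_of L [] (App (Lam \<tau> K) M) = Some \<sigma>"
        using at by (auto simp: atom_def formula_def ty_of_apps simp del: ty_of_App)
      then show ?thesis
        using eval_open_at[OF itp that] at unfolding eval_apps by (simp add: atom_def)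
    qed
    then show ?thesis
      using var(1)[OF beta(2)] by (auto simp: beta(1) models_def true_at_def)
  next
    case (constraint_refutation n G \<Phi>)
    \<comment> \<open>The background parts hold in \<open>B\<close> by themselves, so
      \<open>A\<close> and \<open>B\<close> satisfy a set that the side condition declares
      unsatisfiable.\<close>
    have "models L B (Goal (\<Phi> j))" if "j < n" for j
      by (rule models_background_part[where G = "G j", OF itp var(1) var(2)])
         (use constraint_refutation that in auto)
    then have "satisfiable L \<AA> {Goal (\<Phi> j) |j. j < n}"
      using B unfolding satisfiable_def by blast
    then show ?thesis
      using constraint_refutation by blast
  qed
qed

lemma steps_sound:
  assumes "language L" and "\<forall>A\<in>\<AA>. fo_structure L A"
    and \<Gamma>: "\<forall>C\<in>\<Gamma>. hochc L C" and steps: "(step L \<AA>)\<^sup>*\<^sup>* \<Gamma> (\<Gamma>' \<union> {Bottom})"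
  shows "\<not> satisfiable L \<AA> \<Gamma>"
proof
  assume "satisfiable L \<AA> \<Gamma>"
  then obtain A B where AB: "A \<in> \<AA>" "expansion L A B" "\<forall>C\<in>\<Gamma>. models L B C"
    by (auto simp: satisfiable_def)
  have "\<forall>C\<in>\<Delta>. models L B C" if "(step L \<AA>)\<^sup>*\<^sup>* \<Gamma> \<Delta>" for \<Delta>
    using that
  proof induction
    case (step \<Delta> \<Delta>')
    then show ?case
      using derivable_sound[OF assms(1,2) AB(1,2), of \<Delta>] hochc_steps[OF step.hyps(1) \<Gamma>]
      by (auto simp: step_def)
  qed (use AB in simp)
  then have "models L B Bottom"
    using steps by blast
  moreover interpret standard_frame L B
    using expansion_fo_structure(1)[OF assms(1) _ AB(2)] assms(2) AB(1) by blast
  obtain \<alpha> where "valuation L B \<alpha>"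
    using ex_valuation by blast
  ultimately show False
    by (auto simp: models_def)
qed

section \<open>Heads and background atoms\<close>

fun head :: "('c, 'x) trm \<Rightarrow> ('c, 'x) trm" where
  "head (App M N) = head M"
| "head M = M"

fun args :: "('c, 'x) trm \<Rightarrow> ('c, 'x) trm list" where
  "args (App M N) = args M @ [N]"
| "args M = []"

lemma head_apps [simp]: "head (apps M Ns) = head M"
  by (induction Ns arbitrary: M) auto

lemma args_apps [simp]: "args (apps M Ns) = args M @ Ns"
  by (induction Ns arbitrary: M) auto

lemma apps_head_args: "apps (head M) (args M) = M"
  by (induction M) auto

lemma head_neq_App: "head M \<noteq> App N N'"
  by (induction M) auto

text \<open>Typability in the empty context excludes an index as head, logic-freeness excludes
  logical symbols, and an abstraction without arguments has a function type rather than
  \<open>Prop\<close>.\<close>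

lemma atom_cases [consumes 1, case_names Free Sym Lam]:
  assumes "atom L M"
  obtains x Ns where "M = apps (Free x) Ns"
  | c Ns where "M = apps (Sym c) Ns" "c \<in> sig L"
  | \<tau> K N Ns where "M = apps (App (Lam \<tau> K) N) Ns"
proof -
  have "logic_free (head M)"
    using assms logic_free_apps[of "head M" "args M"] by (simp add: atom_def apps_head_args)
  have ty: "ty_of L [] (apps (head M) (args M)) = Some Prop"
    using assms by (simp add: apps_head_args atom_def formula_def)
  show ?thesis
  proof (cases "head M")
    case (Lam \<tau> K)
    have M: "M = apps (Lam \<tau> K) (args M)"
      using Lam apps_head_args[of M] by simp
    show ?thesis
    proof (cases "args M")
      case Nil
      then have "M = Lam \<tau> K"
        using M by simp
      then show ?thesis
        using assms by (auto simp: atom_def formula_def)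
    next
      case (Cons N Ns)
      then have "M = apps (App (Lam \<tau> K) N) Ns"
        using M by simp
      then show ?thesis
        by (rule that(3))
    qed
  next
    case (Sym c)
    then have M: "M = apps (Sym c) (args M)"
      using apps_head_args[of M] by simp
    moreover have "c \<in> sig L"
      using ty Sym by (auto simp: ty_of_apps split: if_splits)
    ultimately show ?thesis
      by (rule that(2))
  next
    case (Free x)
    then show ?thesis
      using that(1) apps_head_args[of M] by metis
  next
    case (Bound i)
    then show ?thesis
      using ty by (auto simp: ty_of_apps)
  next
    case (App N N')
    then show ?thesis
      using head_neq_App by metis
  qed (use \<open>logic_free (head M)\<close> in auto)
qed

lemma first_order_apps [simp]:
  "first_order L (apps M Ns) \<longleftrightarrow> first_order L M \<and> (\<forall>N\<in>set Ns. first_order L N)"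
  by (induction Ns arbitrary: M) auto

text \<open>A function type of \<open>tys L\<close> with non-relational result is not relational,
  hence first-order, so its argument is an individual and the induction applies to it. Abstractions
  do not occur, their types being relational.\<close>

lemma first_order_if_not_relational:
  assumes "language L"
  shows "ty_of L [] M = Some \<tau> \<Longrightarrow> \<not> relational \<tau> \<Longrightarrow> first_order L M"
proof (induction M arbitrary: \<tau>)
  case (Free x)
  moreover have "argument_type (vty L x)"
    using assms by (simp add: language_def)
  ultimately show ?case
    by (auto simp: argument_type_def)
next
  case (Sym c)
  then have "c \<in> sig L" "\<not> relational (cty L c)"
    by (auto split: if_splits)
  then show ?case
    using assms unfolding language_def by (metis DiffI first_order.simps(3))
next
  case (App M N)
  then obtain \<sigma> where \<sigma>: "ty_of L [] M = Some (Arr \<sigma> \<tau>)" "ty_of L [] N = Some \<sigma>"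
    by auto
  then have "Arr \<sigma> \<tau> \<in> tys L"
    using ty_of_in_tys[OF assms \<sigma>(1)] by simp
  then have "relational (Arr \<sigma> \<tau>) \<or> fo_type (Arr \<sigma> \<tau>)"
    using assms unfolding language_def by blast
  then have "\<sigma> = Ind"
    using App.prems(2) by auto
  then show ?case
    using App \<sigma> by auto
qed (auto simp: argument_type_def split: if_splits)

lemma fo_type_foldr: "fo_type (foldr Arr Us Prop) \<Longrightarrow> U \<in> set Us \<Longrightarrow> U = Ind"
proof (induction Us)
  case (Cons V Us)
  then show ?case by (cases Us) auto
qed simp

text \<open>A background symbol takes only individuals, and terms of type \<open>Ind\<close> are
  first-order. So the head alone identifies a background atom.\<close>

lemma background_atom_if_bsig:
  assumes "language L" and "atom L (apps (Sym c) Ms)" and "c \<in> bsig L"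
  shows "background_atom L (apps (Sym c) Ms)"
proof -
  obtain Us where Us: "cty L c = foldr Arr Us Prop" "map (ty_of L []) Ms = map Some Us"
    using assms(2) by (auto simp: atom_def formula_def ty_of_apps split: if_splits)
  have fo: "fo_type (cty L c)"
    using assms(1,3) unfolding language_def by blast
  have "ty_of L [] M = Some Ind" if M: "M \<in> set Ms" for M
  proof -
    have "ty_of L [] M \<in> set (map Some Us)"
      using M unfolding Us(2)[symmetric] by simp
    then show ?thesis
      using fo_type_foldr[of Us] fo Us(1) by auto
  qed
  then show ?thesis
    using assms first_order_if_not_relational[OF assms(1)] by (auto simp: background_atom_def)
qed

text \<open>Variables are moved one at a time, each by a transposition with a fresh variable of the
  same type, so the result stays a type-preserving bijection.\<close>

lemma ex_renaming_apart:
  assumes "language L" and "finite X" and "finite Y"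
  shows "\<exists>\<pi>. bij \<pi> \<and> (\<forall>x. vty L (\<pi> x) = vty L x) \<and> \<pi> ` X \<inter> Y = {}"
  using assms(2)
proof induction
  case empty
  show ?case by (rule exI[of _ "\<lambda>x. x"]) (simp add: bij_def)
next
  case (insert x X)
  then obtain \<pi> where \<pi>: "bij \<pi>" "\<And>x. vty L (\<pi> x) = vty L x" "\<pi> ` X \<inter> Y = {}"
    by blast
  have "infinite {y. vty L y = vty L x}"
    using assms(1) unfolding language_def by blast
  then obtain z where z: "vty L z = vty L x" "z \<notin> Y \<union> \<pi> ` X"
    using insert.hyps(1) assms(3)
    by (metis (mono_tags, lifting) finite_UnI finite_imageI finite_subset mem_Collect_eq subsetI)
  \<comment> \<open>Neither \<open>\<pi> x\<close> nor \<open>z\<close> is the image of an element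
    of \<open>X\<close>, so the swap does not disturb the variables already moved.\<close>
  let ?\<pi> = "transpose (\<pi> x) z \<circ> \<pi>"
  have "\<pi> x \<notin> \<pi> ` X"
    using \<pi>(1) insert.hyps(2) by (auto simp: bij_def inj_def)
  then have "?\<pi> ` X = \<pi> ` X"
    using z(2) by (intro image_cong) (auto simp: transpose_def image_iff)
  then have "?\<pi> ` insert x X \<inter> Y = {}"
    using \<pi>(3) z(2) by auto
  moreover have "bij ?\<pi>"
    using \<pi>(1) by (simp add: bij_comp)
  moreover have "vty L (?\<pi> y) = vty L y" for y
    using \<pi>(2) z(1) by (auto simp: transpose_def) metis
  ultimately show ?case by blast
qed

section \<open>The canonical expansion\<close>

text \<open>The variable \<open>(\<tau>, v)\<close> is a name for the value \<open>v\<close> of type \<open>\<tau>\<close>; so every element of the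
  domain is denoted by a term, whatever the number of variables of the language.\<close>

type_synonym ('c, 'v) vtrm = "('c, ty \<times> 'v) trm"

text \<open>Evaluates applicative terms without any valuation, since a name carries its
  value.\<close>

fun ival :: "('c, 'v) struct \<Rightarrow> ('c, 'v) vtrm \<Rightarrow> 'v" where
  "ival A (Free y) = snd y"
| "ival A (Sym c) = itp A c"
| "ival A (App M N) = app A (ival A M) (ival A N)"
| "ival A _ = undefined"

lemma eval_eq_ival:
  assumes "\<And>x. vty L x = Ind \<Longrightarrow> \<alpha> x = ival A (\<theta> x)"
  shows "first_order L M \<Longrightarrow> logic_free M \<Longrightarrow> eval L A \<alpha> [] M = ival A (hsub \<theta> M)"
  by (induction M) (auto intro: assms)

section \<open>Provability and the logical relation\<close>

locale canonical = standard_frame L A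
  for L :: "('c, 'x) lang" and A :: "('c, 'v) struct" +
  fixes \<Gamma> :: "('c, 'x) clause set"
  assumes hochc: "\<forall>C\<in>\<Gamma>. hochc L C"
    and itp_bsig: "c \<in> bsig L \<Longrightarrow> itp A c \<in> Dom A (cty L c)"
begin

text \<open>The condition on individual variables lets the substitution induce a valuation of
  them.\<close>

definition admissible :: "('x \<Rightarrow> ('c, 'v) vtrm) \<Rightarrow> bool" where
  "admissible s \<longleftrightarrow> (\<forall>x. lc_at 0 (s x) \<and> (vty L x = Ind \<longrightarrow> ival A (s x) \<in> Dom A Ind))"

text \<open>The first two rules cover the literals that a constraint refutation tolerates, the other
  two run \<beta>-reduction and resolution on instances. Typing enters only through the clauses,
  when a proof is lifted.\<close>

inductive prov :: "('c, 'v) vtrm \<Rightarrow> bool" where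
  prov_Free: "prov (apps (Free y) Ms)"
| prov_bsig: "c \<in> bsig L \<Longrightarrow> holds A (ival A (apps (Sym c) Ms)) \<Longrightarrow> prov (apps (Sym c) Ms)"
| prov_beta: "prov (apps (open_at 0 M K) Ns) \<Longrightarrow> prov (apps (App (Lam \<tau> K) M) Ns)"
| prov_clause: "Definite G R xs \<in> \<Gamma> \<Longrightarrow> admissible s \<Longrightarrow> (\<And>M. M \<in># G \<Longrightarrow> prov (hsub s M)) \<Longrightarrow>
    prov (apps (Sym R) (map s xs))"

text \<open>Truth is tied to provability in one direction only, the one that completeness uses.
  Local closure is kept at every type because terms are plugged in without lifting.\<close>

primrec lrel :: "ty \<Rightarrow> 'v \<Rightarrow> ('c, 'v) vtrm \<Rightarrow> bool" where
  "lrel Ind d M \<longleftrightarrow> lc_at 0 M \<and> ival A M = d"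
| "lrel Prop d M \<longleftrightarrow> lc_at 0 M \<and> (holds A d \<longrightarrow> prov M)"
| "lrel (Arr \<sigma> \<tau>) d M \<longleftrightarrow> lc_at 0 M \<and>
     (\<forall>v N. v \<in> Dom A \<sigma> \<longrightarrow> lrel \<sigma> v N \<longrightarrow> lrel \<tau> (app A d v) (App M N))"

lemma lrel_lc: "lrel \<tau> d M \<Longrightarrow> lc_at 0 M"
  by (cases \<tau>) auto

primrec lrels :: "ty \<Rightarrow> 'v list \<Rightarrow> ('c, 'v) vtrm list \<Rightarrow> bool" where
  "lrels Ind ds Ms \<longleftrightarrow> ds = [] \<and> Ms = []"
| "lrels Prop ds Ms \<longleftrightarrow> ds = [] \<and> Ms = []"
| "lrels (Arr \<sigma> \<tau>) ds Ms \<longleftrightarrow>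
     (\<exists>d ds' M Ms'. ds = d # ds' \<and> Ms = M # Ms' \<and> d \<in> Dom A \<sigma> \<and> lrel \<sigma> d M \<and> lrels \<tau> ds' Ms')"

lemma lrels_foldr:
  "lrels (foldr Arr (map g xs) Prop) (map \<beta> xs) Ms \<Longrightarrow>
   list_all2 (\<lambda>x M. lrel (g x) (\<beta> x) M) xs Ms"
  by (induction xs arbitrary: Ms) auto

text \<open>Atoms headed by a variable are provable outright, so at relational types such terms are
  related to every value. \<open>Ms\<close> accumulates arguments while the induction descends
  through the type.\<close>

lemma lrel_Free:
  "relational \<rho> \<Longrightarrow> \<forall>M\<in>set Ms. lc_at 0 M \<Longrightarrow> lrel \<rho> d (apps (Free y) Ms)"
proof (induction \<rho> arbitrary: d Ms)
  case (Arr \<sigma> \<tau>)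
  have "lrel \<tau> v (App (apps (Free y) Ms) N)" if "lc_at 0 N" for v N
    using Arr.IH(2)[of "Ms @ [N]" v] Arr.prems that by simp
  then show ?case
    using Arr.prems by (auto dest: lrel_lc)
qed (auto intro: prov_Free)

text \<open>First-order types take only individuals, which are related exactly to the terms denoting
  them, so value and term are applied in step. At \<open>Prop\<close>, \<open>prov_bsig\<close>
  turns truth into provability.\<close>

lemma lrel_bsig:
  assumes "c \<in> bsig L"
  shows "fo_type \<sigma> \<or> \<sigma> = Prop \<Longrightarrow> \<forall>M\<in>set Ms. lc_at 0 M \<Longrightarrow>
    lrel \<sigma> (ival A (apps (Sym c) Ms)) (apps (Sym c) Ms)"
proof (induction \<sigma> arbitrary: Ms)
  case (Arr \<sigma> \<tau>)
  have "lrel \<tau> (app A (ival A (apps (Sym c) Ms)) (ival A N)) (App (apps (Sym c) Ms) N)"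
    if "lc_at 0 N" for N
    using Arr.IH(2)[of "Ms @ [N]"] Arr.prems that by auto
  then show ?case
    using Arr.prems by auto
qed (auto intro: prov_bsig[OF assms])

text \<open>Closure under head expansion: \<open>prov_beta\<close> settles \<open>Prop\<close>, and
  function types only append an argument to \<open>Ns\<close>.\<close>

lemma lrel_beta:
  "relational \<rho> \<Longrightarrow> lrel \<rho> d (apps (open_at 0 M K) Ns) \<Longrightarrow>
   lc_at 0 (apps (App (Lam \<tau> K) M) Ns) \<Longrightarrow> lrel \<rho> d (apps (App (Lam \<tau> K) M) Ns)"
proof (induction \<rho> arbitrary: d Ns)
  case (Arr \<sigma> \<rho>)
  have "lrel \<rho> (app A d v) (App (apps (App (Lam \<tau> K) M) Ns) N)"
    if "v \<in> Dom A \<sigma>" "lrel \<sigma> v N" for v N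
    using Arr.IH(2)[of "app A d v" "Ns @ [N]"] Arr.prems that lrel_lc[OF that(2)] by simp
  then show ?case
    using Arr.prems by auto
qed (auto intro: prov_beta)

text \<open>Reduces relatedness of a coded relation to its full applications;
  \<open>canonical_rel\<close> is designed to meet the last premise.\<close>

lemma lrel_pred_code:
  "relational \<rho> \<Longrightarrow> \<rho> \<in> tys L \<Longrightarrow> lc_at 0 M \<Longrightarrow>
   (\<And>ds Ms. lrels \<rho> ds Ms \<Longrightarrow> P ds \<Longrightarrow> prov (apps M Ms)) \<Longrightarrow> lrel \<rho> (pred_code A \<rho> P) M"
proof (induction \<rho> arbitrary: M P)
  case (Arr \<sigma> \<tau>)
  have "lrel \<tau> (app A (pred_code A (Arr \<sigma> \<tau>) P) d) (App M N)"
    if dN: "d \<in> Dom A \<sigma>" "lrel \<sigma> d N" for d N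
    unfolding app_pred_code[OF Arr.prems(1,2) dN(1)]
  proof (rule Arr.IH(2))
    fix ds Ms assume "lrels \<tau> ds Ms" "P (d # ds)"
    then show "prov (apps (App M N) Ms)"
      using Arr.prems(4)[of "d # ds" "N # Ms"] dN by auto
  qed (use Arr.prems dN language_Arr[OF language Arr.prems(2)] in \<open>auto dest: lrel_lc\<close>)
  then show ?case
    using Arr.prems(3) by simp
qed auto

text \<open>The interpretation of \<open>R\<close> is the largest one that is below the term \<open>R\<close> in the logical
  relation.\<close>

definition canonical_rel :: "'c \<Rightarrow> 'v list \<Rightarrow> bool" where
  "canonical_rel R ds \<longleftrightarrow> (\<forall>Ms. lrels (cty L R) ds Ms \<longrightarrow> prov (apps (Sym R) Ms))"

definition canonical_struct :: "('c, 'v) struct" where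
  "canonical_struct = A\<lparr>itp := \<lambda>c. if c \<in> bsig L then itp A c
     else pred_code A (cty L c) (canonical_rel c)\<rparr>"

section \<open>The canonical structure and the fundamental lemma\<close>

lemma canonical_struct_simps [simp]:
  "Dom canonical_struct = Dom A" "app canonical_struct = app A"
  "truth canonical_struct = truth A" "holds canonical_struct = holds A"
  "fn_code canonical_struct = fn_code A"
  by (auto simp: canonical_struct_def holds_def fn_code_def fun_eq_iff)

lemma relational_cty: "c \<in> sig L - bsig L \<Longrightarrow> relational (cty L c)"
  using language unfolding language_def by blast

lemma itp_canonical_struct: "c \<in> sig L \<Longrightarrow> itp canonical_struct c \<in> Dom A (cty L c)"
  using itp_bsig[of c] pred_code_in_Dom relational_cty[of c] language_cty[OF language]
  by (auto simp: canonical_struct_def)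

lemma standard_frame_canonical_struct: "standard_frame L canonical_struct"
  using language standard by unfold_locales (auto simp: standard_def)

lemma valuation_canonical_struct [simp]: "valuation L canonical_struct = valuation L A"
  by (auto simp: valuation_def fun_eq_iff)

lemma lrel_Sym:
  assumes "c \<in> sig L"
  shows "lrel (cty L c) (itp canonical_struct c) (Sym c)"
proof (cases "c \<in> bsig L")
  case True
  then have "fo_type (cty L c)"
    using language unfolding language_def by blast
  then show ?thesis
    using lrel_bsig[OF True, of "cty L c" "[]"] True by (simp add: canonical_struct_def)
next
  case False
  then show ?thesis
    using lrel_pred_code[of "cty L c" "Sym c" "canonical_rel c"] assms relational_cty[of c]
      language_cty[OF language assms]
    by (auto simp: canonical_struct_def canonical_rel_def)
qed

text \<open>The fundamental lemma. An open term is closed by \<open>s\<close> and by the terms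
  \<open>Ns\<close>, related to the values in \<open>e\<close> position by position, so that the
  induction passes under binders.\<close>

lemma lrel_eval:
  assumes \<beta>: "valuation L A \<beta>" and lc: "\<And>x. lc_at 0 (s x)"
    and s: "\<And>x. vty L x \<in> tys L \<Longrightarrow> lrel (vty L x) (\<beta> x) (s x)"
  shows "logic_free M \<Longrightarrow> ty_of L (map fst e) M = Some \<tau> \<Longrightarrow>
    list_all2 (\<lambda>(\<sigma>, v) N. \<sigma> \<in> tys L \<and> v \<in> Dom A \<sigma> \<and> lrel \<sigma> v N) e Ns \<Longrightarrow>
    lrel \<tau> (eval L canonical_struct \<beta> e M) (psub s 0 Ns M)"
proof (induction M arbitrary: e \<tau> Ns)
  case (Bound i)
  then show ?case
    by (auto simp: list_all2_conv_all_nth split: if_splits prod.splits)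
next
  case (Free x)
  then show ?case using s by auto
next
  case (Sym c)
  then show ?case using lrel_Sym by (auto split: if_splits)
next
  case (App M N)
  then obtain \<sigma> where \<sigma>: "ty_of L (map fst e) M = Some (Arr \<sigma> \<tau>)"
    "ty_of L (map fst e) N = Some \<sigma>"
    by auto
  \<comment> \<open>The relation at function types quantifies only over values in the domain, so it
    applies only after this.\<close>
  have "eval L canonical_struct \<beta> e N \<in> Dom canonical_struct \<sigma>"
  proof (rule standard_frame.eval_in_Dom[OF standard_frame_canonical_struct])
    show "\<upsilon> \<in> tys L \<and> v \<in> Dom canonical_struct \<upsilon>" if "(\<upsilon>, v) \<in> set e" for \<upsilon> v
      using App.prems(3) that by (auto simp: list_all2_conv_all_nth in_set_conv_nth)
  qed (use App.prems \<sigma> \<beta> itp_canonical_struct in auto)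
  moreover have "lrel (Arr \<sigma> \<tau>) (eval L canonical_struct \<beta> e M) (psub s 0 Ns M)"
    "lrel \<sigma> (eval L canonical_struct \<beta> e N) (psub s 0 Ns N)"
    using App.IH App.prems \<sigma> by (simp_all del: lrel.simps)
  ultimately show ?case
    by simp
next
  case (Lam \<sigma> M)
  then obtain \<rho> where \<rho>: "ty_of L (\<sigma> # map fst e) M = Some \<rho>" "relational \<rho>" "Arr \<sigma> \<rho> \<in> tys L"
    "\<tau> = Arr \<sigma> \<rho>"
    by auto
  have Ns: "lc_at 0 N" if "N \<in> set Ns" for N
    using Lam.prems(3) that by (auto simp: list_all2_conv_all_nth in_set_conv_nth dest: lrel_lc)
  have len: "length e = length Ns"
    using Lam.prems(3) by (rule list_all2_lengthD)
  have lc_M: "lc_at 0 (Lam \<sigma> (psub s (Suc 0) Ns M))"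
    using lc_at_psub[where k = "Suc 0" and M = M, OF lc Ns] lc_at_ty_of[OF \<rho>(1)] len by simp
  have dom: "eval L canonical_struct \<beta> ((\<sigma>, v) # e) M \<in> Dom A \<rho>" if "v \<in> Dom A \<sigma>" for v
  proof -
    have "eval L canonical_struct \<beta> ((\<sigma>, v) # e) M \<in> Dom canonical_struct \<rho>"
    proof (rule standard_frame.eval_in_Dom[OF standard_frame_canonical_struct])
      show "\<upsilon> \<in> tys L \<and> w \<in> Dom canonical_struct \<upsilon>" if "(\<upsilon>, w) \<in> set ((\<sigma>, v) # e)" for \<upsilon> w
        using Lam.prems(3) that \<open>v \<in> Dom A \<sigma>\<close> language_Arr[OF language \<rho>(3)]
        by (auto simp: list_all2_conv_all_nth in_set_conv_nth)
    qed (use Lam.prems \<rho> \<beta> itp_canonical_struct in auto)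
    then show ?thesis by simp
  qed
  have "lrel \<rho> (app A (eval L canonical_struct \<beta> e (Lam \<sigma> M)) v)
      (App (Lam \<sigma> (psub s (Suc 0) Ns M)) N)"
    if vN: "v \<in> Dom A \<sigma>" "lrel \<sigma> v N" for v N
  proof -
    have "lrel \<rho> (eval L canonical_struct \<beta> ((\<sigma>, v) # e) M) (psub s 0 (N # Ns) M)"
      using Lam.IH[of "(\<sigma>, v) # e" \<rho> "N # Ns"] Lam.prems \<rho> vN language_Arr[OF language \<rho>(3)]
      by auto
    \<comment> \<open>Replacing index 0 by \<open>N\<close> gives the contractum; head expansion
      then reaches the redex itself.\<close>
    then have "lrel \<rho> (eval L canonical_struct \<beta> ((\<sigma>, v) # e) M)
        (open_at 0 N (psub s (Suc 0) Ns M))"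
      by (simp add: open_at_psub[OF lc Ns])
    then have "lrel \<rho> (eval L canonical_struct \<beta> ((\<sigma>, v) # e) M)
        (App (Lam \<sigma> (psub s (Suc 0) Ns M)) N)"
      using lrel_beta[of \<rho> _ N "psub s (Suc 0) Ns M" "[]" \<sigma>] \<rho>(2) lc_M lrel_lc[OF vN(2)] by simp
    then show ?thesis
      using app_fn_code[OF \<rho>(3) dom vN(1)] \<rho>(1) by simp
  qed
  then show ?case
    using lc_M \<rho>(4) by simp
qed auto

section \<open>Truth of the definite clauses\<close>

lemma prov_if_true_at:
  assumes "valuation L A \<beta>" and "\<And>x. lc_at 0 (s x)"
    and "\<And>x. vty L x \<in> tys L \<Longrightarrow> lrel (vty L x) (\<beta> x) (s x)"
    and "atom L M" and "true_at L canonical_struct \<beta> M"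
  shows "prov (hsub s M)"
  using lrel_eval[OF assms(1-3), of M "[]" Prop "[]"] assms(4,5)
  by (simp add: atom_def formula_def true_at_def psub_Nil)

lemma lrel_name:
  assumes "vty L x \<in> tys L"
  shows "lrel (vty L x) d (Free (vty L x, d))"
  using lrel_Free[of "vty L x" "[]"] argument_type_vty[of x] by (auto simp: argument_type_def)

lemma admissible_if_lrel:
  assumes "valuation L A \<beta>" and "\<And>x. lc_at 0 (s x)"
    and "\<And>x. vty L x \<in> tys L \<Longrightarrow> lrel (vty L x) (\<beta> x) (s x)"
  shows "admissible s"
  unfolding admissible_def
proof (intro allI conjI impI)
  fix x assume "vty L x = Ind"
  moreover have "Ind \<in> tys L"
    using language by (simp add: language_def)
  ultimately show "ival A (s x) \<in> Dom A Ind"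
    using assms(3)[of x] assms(1) unfolding valuation_def by (metis lrel.simps(1))
qed (rule assms(2))

lemma ex_extension:
  assumes "list_all2 Q xs Ms" and "distinct xs" and "\<And>x. Q x (d x)"
  shows "\<exists>s. map s xs = Ms \<and> (\<forall>x. Q x (s x))"
  using assms(1,2)
proof (induction rule: list_all2_induct)
  case Nil
  then show ?case using assms(3) by auto
next
  case (Cons x xs M Ms)
  then obtain s where "map s xs = Ms" "\<forall>x. Q x (s x)" by auto
  then show ?case
    using Cons by (intro exI[of _ "s(x := M)"]) auto
qed

text \<open>If the head is false at \<beta>, \<open>canonical_rel\<close> yields related arguments
  \<open>Ms\<close> for which \<open>apps (Sym R) Ms\<close> is unprovable. A true body would be
  provable under a substitution sending \<open>xs\<close> to \<open>Ms\<close>, and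
  \<open>prov_clause\<close> would prove that atom.\<close>

lemma models_Definite:
  assumes "Definite G R xs \<in> \<Gamma>"
  shows "models L canonical_struct (Definite G R xs)"
  unfolding models_def clause_true_at.simps
proof (intro allI impI disjCI)
  fix \<beta> assume "valuation L canonical_struct \<beta>"
  then have \<beta>: "valuation L A \<beta>" by simp
  assume "\<not> true_at L canonical_struct \<beta> (apps (Sym R) (map Free xs))"
  have C: "hochc L (Definite G R xs)"
    using hochc assms by blast
  then obtain Us where Us: "cty L R = foldr Arr Us Prop" "R \<in> sig L - bsig L"
    "map (ty_of L []) (map Free xs) = map Some Us" "distinct xs"
    by (auto simp: formula_def ty_of_apps split: if_splits)
  have "length xs = length Us"
    using Us(3) by (metis length_map)
  then have Us_eq: "Us = map (vty L) xs" and xs: "\<And>x. x \<in> set xs \<Longrightarrow> vty L x \<in> tys L"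
    using Us(3) by (auto simp: list_eq_iff_nth_eq in_set_conv_nth)
  have "list_all2 (\<lambda>d U. d \<in> Dom A U) (map \<beta> xs) Us"
    using \<beta> xs by (auto simp: Us_eq list_all2_conv_all_nth valuation_def)
  then have "eval L canonical_struct \<beta> [] (apps (Sym R) (map Free xs)) =
      truth A (canonical_rel R (map \<beta> xs))"
    using foldl_app_pred_code[of Us "map \<beta> xs"] Us(1,2) relational_cty[OF Us(2)]
      language_cty[OF language, of R]
    by (simp add: eval_apps comp_def canonical_struct_def)
  then have "\<not> canonical_rel R (map \<beta> xs)"
    using \<open>\<not> true_at _ _ _ _\<close> by (simp add: true_at_def)
  then obtain Ms where Ms: "lrels (cty L R) (map \<beta> xs) Ms" "\<not> prov (apps (Sym R) Ms)"
    by (auto simp: canonical_rel_def)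
  let ?Q = "\<lambda>x M. lc_at 0 M \<and> (vty L x \<in> tys L \<longrightarrow> lrel (vty L x) (\<beta> x) M)"
  have "list_all2 ?Q xs Ms"
    using lrels_foldr[of "vty L" xs \<beta> Ms] Ms(1) Us(1) Us_eq
    by (auto elim!: list_all2_mono dest: lrel_lc)
  \<comment> \<open>Variables outside \<open>xs\<close> are sent to the names of their
    values.\<close>
  then obtain s where s: "map s xs = Ms" "\<And>x. lc_at 0 (s x)"
    "\<And>x. vty L x \<in> tys L \<Longrightarrow> lrel (vty L x) (\<beta> x) (s x)"
    using ex_extension[of ?Q xs Ms "\<lambda>x. Free (vty L x, \<beta> x)"] Us(4) lrel_name by auto
  show "\<exists>M\<in>#G. \<not> true_at L canonical_struct \<beta> M"
  proof (rule ccontr)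
    assume "\<not> (\<exists>M\<in>#G. \<not> true_at L canonical_struct \<beta> M)"
    then have "prov (hsub s M)" if "M \<in># G" for M
      using prov_if_true_at[OF \<beta> s(2,3)] C that by auto
    then show False
      using prov_clause[OF assms admissible_if_lrel[OF \<beta> s(2,3)]] s(1) Ms(2) by auto
  qed
qed

section \<open>Lifting provability to derivations\<close>

text \<open>Literals that need no further inference: the constraint refutation accepts them, and
  rigid ones are true under \<theta>.\<close>

definition solved :: "('x \<Rightarrow> ('c, 'v) vtrm) \<Rightarrow> ('c, 'x) trm \<Rightarrow> bool" where
  "solved \<theta> M \<longleftrightarrow> (\<exists>x Ms. M = apps (Free x) Ms) \<or>
     background_atom L M \<and> holds A (ival A (hsub \<theta> M))"

text \<open>\<open>H\<close> is the residue of the literals already worked off. Agreement of the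
  substitutions on \<open>G\<close> lets its literals be treated afterwards with the same
  instances.\<close>

definition solvable :: "('c, 'x) clause set \<Rightarrow> ('x \<Rightarrow> ('c, 'v) vtrm) \<Rightarrow> ('c, 'x) trm multiset \<Rightarrow> bool"
  where
  "solvable \<Delta> \<theta> G \<longleftrightarrow> (\<exists>H \<theta>'. Goal (H + G) \<in> \<Delta> \<and> (\<forall>M\<in>#H. solved \<theta>' M) \<and> admissible \<theta>' \<and>
     (\<forall>M\<in>#G. \<forall>x\<in>set2_trm M. \<theta>' x = \<theta> x))"

text \<open>General in the context \<open>G\<close> and the literal \<open>M\<close>, since
  inferences change both during the induction.\<close>

definition liftable :: "('c, 'x) clause set \<Rightarrow> ('c, 'v) vtrm \<Rightarrow> bool" where
  "liftable \<Delta> N \<longleftrightarrow> (\<forall>M G \<theta>. admissible \<theta> \<longrightarrow> hsub \<theta> M = N \<longrightarrow> Goal (add_mset M G) \<in> \<Delta> \<longrightarrow>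
     solvable \<Delta> \<theta> G)"

lemma solved_cong:
  assumes "solved \<theta> M" and "\<And>x. x \<in> set2_trm M \<Longrightarrow> \<theta>' x = \<theta> x"
  shows "solved \<theta>' M"
  using assms hsub_cong[of M \<theta>' \<theta>] by (auto simp: solved_def)

text \<open>The literals of \<open>H\<close> are worked off one by one, with all others as context.
  The residue of one round joins the context of the next, so later substitutions agree on it and it
  stays solved.\<close>

lemma solvable_if_liftable:
  "(\<And>M. M \<in># H \<Longrightarrow> liftable \<Delta> (hsub \<theta> M)) \<Longrightarrow> admissible \<theta> \<Longrightarrow> Goal (H + G) \<in> \<Delta> \<Longrightarrow>
   solvable \<Delta> \<theta> G"
proof (induction H arbitrary: G \<theta>)
  case empty
  then show ?case by (auto simp: solvable_def intro!: exI[of _ "{#}"])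
next
  case (add M H)
  have "solvable \<Delta> \<theta> (H + G)"
    using add.prems unfolding liftable_def by auto
  then obtain H1 \<theta>1 where 1: "Goal (H1 + (H + G)) \<in> \<Delta>" "\<forall>N\<in>#H1. solved \<theta>1 N" "admissible \<theta>1"
    "\<forall>N\<in>#H + G. \<forall>x\<in>set2_trm N. \<theta>1 x = \<theta> x"
    unfolding solvable_def by blast
  have "hsub \<theta>1 N = hsub \<theta> N" if "N \<in># H" for N
    using 1(4) that by (intro hsub_cong) auto
  then have "solvable \<Delta> \<theta>1 (H1 + G)"
    using add.IH[of \<theta>1 "H1 + G"] add.prems(1) 1 by (simp add: ac_simps)
  then obtain H2 \<theta>2 where 2: "Goal (H2 + (H1 + G)) \<in> \<Delta>" "\<forall>N\<in>#H2. solved \<theta>2 N" "admissible \<theta>2"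
    "\<forall>N\<in>#H1 + G. \<forall>x\<in>set2_trm N. \<theta>2 x = \<theta>1 x"
    unfolding solvable_def by blast
  have "solved \<theta>2 N" if "N \<in># H1" for N
    by (rule solved_cong[of \<theta>1]) (use 1(2) 2(4) that in auto)
  then have "\<forall>N\<in>#H2 + H1. solved \<theta>2 N"
    using 2(2) by auto
  moreover have "\<theta>2 x = \<theta> x" if "N \<in># G" "x \<in> set2_trm N" for N x
    using 1(4) 2(4) that by (metis union_iff)
  ultimately show ?case
    unfolding solvable_def using 2(1,3)
    by (intro exI[of _ "H2 + H1"] exI[of _ \<theta>2]) (auto simp: add.assoc)
qed

text \<open>A literal headed by a variable is solved as it stands, whatever its instance. Any other
  kind of head is preserved by \<open>hsub\<close>, so the literal has the shape of \<open>N\<close>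
  and the last rule in the proof of \<open>N\<close> can be imitated on the clause.\<close>

lemma prov_liftable:
  assumes \<Delta>: "\<Gamma> \<subseteq> \<Delta>" "\<forall>C\<in>\<Delta>. hochc L C"
    and closed: "\<And>C. derivable L \<AA> \<Delta> C \<Longrightarrow> C \<in> \<Delta>"
  shows "prov N \<Longrightarrow> liftable \<Delta> N"
proof (induction rule: prov.induct)
  case (prov_Free y Ms)
  show ?case
    unfolding liftable_def
  proof (intro allI impI)
    fix M G \<theta>
    assume *: "admissible \<theta>" "hsub \<theta> M = apps (Free y) Ms" "Goal (add_mset M G) \<in> \<Delta>"
    then have "atom L M" using \<Delta>(2) by force
    then have "solved \<theta> M"
    proof (cases rule: atom_cases)
      case (Sym c Ns)
      then show ?thesis using arg_cong[OF *(2), of head] by simp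
    next
      case (Lam \<tau> K N Ns)
      then show ?thesis using arg_cong[OF *(2), of head] by simp
    qed (auto simp: solved_def)
    then show "solvable \<Delta> \<theta> G"
      unfolding solvable_def using * by (intro exI[of _ "{#M#}"] exI[of _ \<theta>]) auto
  qed
next
  case (prov_bsig c Ms)
  show ?case
    unfolding liftable_def
  proof (intro allI impI)
    fix M G \<theta>
    assume *: "admissible \<theta>" "hsub \<theta> M = apps (Sym c) Ms" "Goal (add_mset M G) \<in> \<Delta>"
    then have "atom L M" using \<Delta>(2) by force
    then have "solved \<theta> M"
    proof (cases rule: atom_cases)
      case (Sym c' Ns)
      then have "c' = c" using arg_cong[OF *(2), of head] by simp
      then show ?thesis
        using background_atom_if_bsig[OF language] \<open>atom L M\<close> Sym(1) prov_bsig *(2)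
        by (auto simp: solved_def)
    next
      case (Lam \<tau> K N Ns)
      then show ?thesis using arg_cong[OF *(2), of head] by simp
    qed (auto simp: solved_def)
    then show "solvable \<Delta> \<theta> G"
      unfolding solvable_def using * by (intro exI[of _ "{#M#}"] exI[of _ \<theta>]) auto
  qed
next
  case (prov_beta N K Ns \<tau>)
  show ?case
    unfolding liftable_def
  proof (intro allI impI)
    fix M G \<theta>
    assume *: "admissible \<theta>" "hsub \<theta> M = apps (App (Lam \<tau> K) N) Ns" "Goal (add_mset M G) \<in> \<Delta>"
    then have "atom L M" using \<Delta>(2) by force
    then show "solvable \<Delta> \<theta> G"
    proof (cases rule: atom_cases)
      case (Free x Ns')
      then have "solved \<theta> M" by (auto simp: solved_def)
      then show "solvable \<Delta> \<theta> G"
        unfolding solvable_def using * by (intro exI[of _ "{#M#}"] exI[of _ \<theta>]) auto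
    next
      case (Sym c Ns')
      then show ?thesis using arg_cong[OF *(2), of head] by simp
    next
      case (Lam \<tau>' K' N' Ns')
      have eqs: "hsub \<theta> K' = K" "hsub \<theta> N' = N" "map (hsub \<theta>) Ns' = Ns"
        using arg_cong[OF *(2), of head] arg_cong[OF *(2), of args] by (auto simp: Lam)
      have "Goal (add_mset (apps (open_at 0 N' K') Ns') G) \<in> \<Delta>"
        using closed[OF derivable.beta] variants_self[OF *(3)] Lam by blast
      moreover have "hsub \<theta> (apps (open_at 0 N' K') Ns') = apps (open_at 0 N K) Ns"
        using *(1) eqs by (simp add: hsub_open_at admissible_def)
      ultimately show ?thesis
        using prov_beta.IH *(1) unfolding liftable_def by blast
    qed
  qed
next
  case (prov_clause G' R xs s)
  have C: "hochc L (Definite G' R xs)"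
    using prov_clause.hyps(1) hochc by blast
  show ?case
    unfolding liftable_def
  proof (intro allI impI)
    fix M G \<theta>
    assume *: "admissible \<theta>" "hsub \<theta> M = apps (Sym R) (map s xs)" "Goal (add_mset M G) \<in> \<Delta>"
    then have "atom L M" using \<Delta>(2) by force
    then show "solvable \<Delta> \<theta> G"
    proof (cases rule: atom_cases)
      case (Free x Ns)
      then have "solved \<theta> M" by (auto simp: solved_def)
      then show "solvable \<Delta> \<theta> G"
        unfolding solvable_def using * by (intro exI[of _ "{#M#}"] exI[of _ \<theta>]) auto
    next
      case (Lam \<tau> K N Ns)
      then show ?thesis using arg_cong[OF *(2), of head] by simp
    next
      case (Sym c Ms)
      have c: "c = R" and Ms: "map (hsub \<theta>) Ms = map s xs"
        using arg_cong[OF *(2), of head] arg_cong[OF *(2), of args] by (auto simp: Sym)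
      then have len: "length Ms = length xs"
        by (metis length_map)
      \<comment> \<open>The variables of the clause are moved away from those of the goal, so that
        one substitution can act as \<open>s\<close> on the former and as \<theta> on the
        latter.\<close>
      define X where "X = set xs \<union> (\<Union>B\<in>set_mset G'. set2_trm B)"
      define Y where "Y = (\<Union>B\<in>set_mset (add_mset M G). set2_trm B)"
      have fin: "finite (set2_trm B)" for B :: "('c, 'x) trm"
        by (induction B) auto
      obtain \<pi> where \<pi>: "bij \<pi>" "\<And>x. vty L (\<pi> x) = vty L x" "\<pi> ` X \<inter> Y = {}"
        using ex_renaming_apart[OF language, of X Y] fin by (auto simp: X_def Y_def)
      have "map_clause id \<pi> (Definite G' R xs) \<in> variants L \<Delta>"
        using prov_clause.hyps(1) \<Delta>(1) \<pi>(1,2) unfolding variants_def by blast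
      then have "Definite (image_mset (map_trm id \<pi>) G') R (map \<pi> xs) \<in> variants L \<Delta>"
        by simp
      moreover have "Goal (add_mset (apps (Sym R) Ms) G) \<in> variants L \<Delta>"
        using variants_self[OF *(3)] Sym c by simp
      ultimately have "derivable L \<AA> \<Delta>
          (Goal (G + image_mset (subst (inst (map \<pi> xs) Ms)) (image_mset (map_trm id \<pi>) G')))"
        using derivable.resolution len by (metis length_map)
      then have goal: "Goal (image_mset (\<lambda>B. subst (inst (map \<pi> xs) Ms) (map_trm id \<pi> B)) G' + G) \<in> \<Delta>"
        using closed by (simp add: image_mset.compositionality comp_def add.commute)
      define \<theta>' where "\<theta>' x = (if x \<in> \<pi> ` X then s (inv \<pi> x) else \<theta> x)" for x
      have \<theta>'_\<pi>: "\<theta>' (\<pi> x) = s x" if "x \<in> X" for x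
        using that \<pi>(1) by (simp add: \<theta>'_def bij_def)
      have \<theta>'_Y: "\<theta>' x = \<theta> x" if "x \<in> Y" for x
        using that \<pi>(3) by (auto simp: \<theta>'_def)
      have "vty L (inv \<pi> x) = vty L x" for x
        using \<pi>(1,2) by (metis bij_inv_eq_iff)
      then have adm: "admissible \<theta>'"
        using *(1) prov_clause.hyps(2) by (auto simp: admissible_def \<theta>'_def)
      have Ms_Y: "set2_trm N \<subseteq> Y" if "N \<in> set Ms" for N
      proof -
        have "set2_trm N \<subseteq> set2_trm (apps H Ms)" for H
          using that by (induction Ms arbitrary: H rule: rev_induct) auto
        then show ?thesis
          by (auto simp: Y_def Sym)
      qed
      \<comment> \<open>Head variables are instantiated by \<open>Ms\<close>, whose instances under
        \<theta> are the \<open>s x\<close>; the other clause variables survive and get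
        \<open>s x\<close> from \<open>\<theta>'\<close> directly.\<close>
      have inst_\<pi>: "hsub \<theta>' (inst (map \<pi> xs) Ms (\<pi> x)) = s x" if "x \<in> X" for x
      proof (cases "x \<in> set xs")
        case True
        then obtain i where i: "i < length xs" "xs ! i = x"
          by (auto simp: in_set_conv_nth)
        have "distinct (map \<pi> xs)"
          using C \<pi>(1) by (auto simp: distinct_map bij_def intro: inj_on_subset)
        then have "map (inst (map \<pi> xs) Ms) (map \<pi> xs) = Ms"
          using len by (intro map_inst) auto
        then have "inst (map \<pi> xs) Ms (\<pi> x) = Ms ! i"
          using i by (metis length_map nth_map)
        moreover have "hsub \<theta>' (Ms ! i) = hsub \<theta> (Ms ! i)"
          using Ms_Y[of "Ms ! i"] i len by (intro hsub_cong \<theta>'_Y) auto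
        moreover have "hsub \<theta> (Ms ! i) = s x"
          using Ms i len by (metis nth_map)
        ultimately show ?thesis by simp
      next
        case False
        then have "\<pi> x \<notin> set (map \<pi> xs)"
          using \<pi>(1) by (auto simp: bij_def inj_def)
        then have "map_of (zip (map \<pi> xs) Ms) (\<pi> x) = None"
          by (auto simp: map_of_eq_None_iff dest: set_zip_leftD)
        then show ?thesis
          using \<theta>'_\<pi>[OF that] by (simp add: inst_def)
      qed
      \<comment> \<open>Each new body literal thus has the instance to which the induction
        hypothesis applies.\<close>
      have "hsub \<theta>' (subst (inst (map \<pi> xs) Ms) (map_trm id \<pi> B)) = hsub s B" if "B \<in># G'" for B
        unfolding subst_eq_hsub map_trm_eq_hsub hsub_hsub
        using that by (intro hsub_cong) (auto intro!: inst_\<pi> simp: X_def)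
      then have "solvable \<Delta> \<theta>' G"
        by (intro solvable_if_liftable[OF _ adm goal]) (use prov_clause.IH in auto)
      moreover have "\<theta>' x = \<theta> x" if "B \<in># G" "x \<in> set2_trm B" for B x
        using that by (intro \<theta>'_Y) (auto simp: Y_def)
      ultimately show ?thesis
        unfolding solvable_def by metis
    qed
  qed
qed

text \<open>If all atoms of \<open>G\<close> were true, lifting their proofs would put into \<Delta>
  a goal clause with only solved literals. Those without a variable at the head are background
  atoms, all true at the valuation induced by the final substitution, against
  \<open>background\<close>.\<close>

lemma models_Goal:
  assumes "Goal G \<in> \<Gamma>" and \<Delta>: "\<Gamma> \<subseteq> \<Delta>" "\<forall>C\<in>\<Delta>. hochc L C"
    and closed: "\<And>C. derivable L \<AA> \<Delta> C \<Longrightarrow> C \<in> \<Delta>"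
    and background: "\<And>F \<Phi>. Goal (F + \<Phi>) \<in> \<Delta> \<Longrightarrow> \<forall>M\<in>#F. \<exists>x Ms. M = apps (Free x) Ms \<Longrightarrow>
      \<forall>M\<in>#\<Phi>. background_atom L M \<Longrightarrow> models L A (Goal \<Phi>)"
  shows "models L canonical_struct (Goal G)"
  unfolding models_def clause_true_at.simps
proof (intro allI impI, rule ccontr)
  fix \<beta> assume "valuation L canonical_struct \<beta>" and G: "\<not> (\<exists>M\<in>#G. \<not> true_at L canonical_struct \<beta> M)"
  then have \<beta>: "valuation L A \<beta>" by simp
  define s where "s x = (Free (vty L x, \<beta> x) :: ('c, 'v) vtrm)" for x
  have s: "\<And>x. lc_at 0 (s x)" "\<And>x. vty L x \<in> tys L \<Longrightarrow> lrel (vty L x) (\<beta> x) (s x)"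
    using lrel_name by (auto simp: s_def)
  have "hochc L (Goal G)"
    using assms(1) hochc by blast
  then have "liftable \<Delta> (hsub s M)" if "M \<in># G" for M
    using that G prov_if_true_at[OF \<beta> s] prov_liftable[where \<AA> = \<AA>, OF \<Delta> closed] by auto
  then have "solvable \<Delta> s {#}"
    using solvable_if_liftable[of G \<Delta> s "{#}"] admissible_if_lrel[OF \<beta> s] assms(1) \<Delta>(1) by auto
  then obtain H \<theta> where H: "Goal H \<in> \<Delta>" "\<forall>M\<in>#H. solved \<theta> M" "admissible \<theta>"
    by (auto simp: solvable_def)
  define flex where "flex M \<longleftrightarrow> (\<exists>x Ms. M = apps (Free x) Ms)" for M :: "('c, 'x) trm"
  define \<Phi> where "\<Phi> = filter_mset (\<lambda>M. \<not> flex M) H"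
  have \<Phi>: "background_atom L M" "holds A (ival A (hsub \<theta> M))" if "M \<in># \<Phi>" for M
    using H(2) that by (auto simp: \<Phi>_def flex_def solved_def)
  have "models L A (Goal \<Phi>)"
  proof (rule background)
    show "Goal (filter_mset flex H + \<Phi>) \<in> \<Delta>"
      using H(1) by (simp add: \<Phi>_def)
  qed (use \<Phi> in \<open>auto simp: flex_def\<close>)
  \<comment> \<open>Background atoms contain only individual variables, valued by \<theta>; the
    others take their values from \<beta> merely to complete the valuation.\<close>
  moreover define \<alpha> where "\<alpha> x = (if vty L x = Ind then ival A (\<theta> x) else \<beta> x)" for x
  have "valuation L A \<alpha>"
    using \<beta> H(3) by (auto simp: valuation_def \<alpha>_def admissible_def)
  ultimately obtain M where M: "M \<in># \<Phi>" "\<not> true_at L A \<alpha> M"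
    by (auto simp: models_def)
  then show False
    using \<Phi>[OF M(1)] eval_eq_ival[of L \<alpha> A \<theta> M]
    by (auto simp: true_at_def \<alpha>_def background_atom_def atom_def)
qed

end

section \<open>Completeness\<close>

lemma variants_mono: "\<Gamma> \<subseteq> \<Delta> \<Longrightarrow> variants L \<Gamma> \<subseteq> variants L \<Delta>"
  by (auto simp: variants_def)

lemma derivable_mono:
  assumes "derivable L \<AA> \<Gamma> C" and "\<Gamma> \<subseteq> \<Delta>"
  shows "derivable L \<AA> \<Delta> C"
  using assms(1)
proof cases
  case (constraint_refutation n G \<Phi>)
  show ?thesis
    unfolding constraint_refutation(1)
    by (rule derivable.constraint_refutation[of n G \<Phi>])
       (use constraint_refutation variants_mono[OF assms(2), of L] in auto)
qed (use variants_mono[OF assms(2), of L] in \<open>auto intro: derivable.intros\<close>)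

lemma steps_mono:
  assumes "(step L \<AA>)\<^sup>*\<^sup>* \<Gamma> \<Delta>" and "\<Gamma> \<subseteq> \<Gamma>'"
  shows "(step L \<AA>)\<^sup>*\<^sup>* \<Gamma>' (\<Gamma>' \<union> \<Delta>)"
  using assms(1)
proof induction
  case base
  then show ?case using assms(2) by (simp add: Un_absorb2)
next
  case (step \<Delta> \<Delta>')
  then obtain C where C: "derivable L \<AA> \<Delta> C" "\<Delta>' = \<Delta> \<union> {C}"
    by (auto simp: step_def)
  then have "derivable L \<AA> (\<Gamma>' \<union> \<Delta>) C"
    using derivable_mono by blast
  then have "step L \<AA> (\<Gamma>' \<union> \<Delta>) (\<Gamma>' \<union> \<Delta>')"
    unfolding step_def C(2) by blast
  with step.IH show ?case by simp
qed

text \<open>The union need not itself be reachable in finitely many steps.\<close>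

definition consequences :: "('c, 'x) lang \<Rightarrow> ('c, 'v) struct set \<Rightarrow> ('c, 'x) clause set
    \<Rightarrow> ('c, 'x) clause set" where
  "consequences L \<AA> \<Gamma> = \<Union>{\<Delta>. (step L \<AA>)\<^sup>*\<^sup>* \<Gamma> \<Delta>}"

text \<open>Reachable sets are directed: by \<open>steps_mono\<close>, one derivation can be
  replayed after another.\<close>

lemma consequences_finite:
  assumes "finite S" and "S \<subseteq> consequences L \<AA> \<Gamma>"
  shows "\<exists>\<Delta>. (step L \<AA>)\<^sup>*\<^sup>* \<Gamma> \<Delta> \<and> S \<subseteq> \<Delta> \<and> \<Gamma> \<subseteq> \<Delta>"
  using assms
proof induction
  case empty
  show ?case by (rule exI[of _ \<Gamma>]) simp
next
  case (insert C S)
  then obtain \<Delta> \<Delta>' where "(step L \<AA>)\<^sup>*\<^sup>* \<Gamma> \<Delta>" "S \<subseteq> \<Delta>" "\<Gamma> \<subseteq> \<Delta>"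
    "(step L \<AA>)\<^sup>*\<^sup>* \<Gamma> \<Delta>'" "C \<in> \<Delta>'"
    by (auto simp: consequences_def)
  then show ?case
    using steps_mono[of L \<AA> \<Gamma> \<Delta>' \<Delta>]
    by (intro exI[of _ "\<Delta> \<union> \<Delta>'"]) (auto intro: rtranclp_trans)
qed

lemma derivable_finite:
  assumes "derivable L \<AA> \<Gamma> C"
  shows "\<exists>S\<subseteq>\<Gamma>. finite S \<and> derivable L \<AA> S C"
proof -
  have one: "\<exists>E\<in>\<Gamma>. D \<in> variants L {E}" if "D \<in> variants L \<Gamma>" for D
    using that by (auto simp: variants_def)
  show ?thesis
    using assms
  proof cases
    case (resolution R Ms G G' xs)
    obtain E E' where E: "E \<in> \<Gamma>" "Goal (add_mset (apps (Sym R) Ms) G) \<in> variants L {E}"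
      "E' \<in> \<Gamma>" "Definite G' R xs \<in> variants L {E'}"
      using one resolution by blast
    then have "derivable L \<AA> {E, E'} C"
      unfolding resolution(1)
      by (intro derivable.resolution[OF _ _ resolution(4)])
         (use variants_mono[of "{E}" "{E, E'}" L] variants_mono[of "{E'}" "{E, E'}" L] in auto)
    then show ?thesis
      using E by (intro exI[of _ "{E, E'}"]) auto
  next
    case (beta \<tau> K M Ns G)
    obtain E where "E \<in> \<Gamma>" "Goal (add_mset (apps (App (Lam \<tau> K) M) Ns) G) \<in> variants L {E}"
      using one beta by blast
    then show ?thesis
      unfolding beta(1) by (intro exI[of _ "{E}"]) (auto intro: derivable.beta)
  next
    case (constraint_refutation n G \<Phi>)
    have "\<forall>j. \<exists>E. j < n \<longrightarrow> E \<in> \<Gamma> \<and> Goal (G j + \<Phi> j) \<in> variants L {E}"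
      using one constraint_refutation(2) by blast
    then obtain E where E: "\<And>j. j < n \<Longrightarrow> E j \<in> \<Gamma> \<and> Goal (G j + \<Phi> j) \<in> variants L {E j}"
      by metis
    have "derivable L \<AA> (E ` {..<n}) C"
      unfolding constraint_refutation(1)
    proof (rule derivable.constraint_refutation[of n G \<Phi>])
      fix j assume "j < n"
      then show "Goal (G j + \<Phi> j) \<in> variants L (E ` {..<n})"
        using E variants_mono[of "{E j}" "E ` {..<n}" L] by blast
    qed (use constraint_refutation in auto)
    then show ?thesis
      using E by (intro exI[of _ "E ` {..<n}"]) auto
  qed
qed

lemma consequences_closed:
  assumes "derivable L \<AA> (consequences L \<AA> \<Gamma>) C"
  shows "C \<in> consequences L \<AA> \<Gamma>"
proof -
  obtain S where S: "S \<subseteq> consequences L \<AA> \<Gamma>" "finite S" "derivable L \<AA> S C"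
    using derivable_finite[OF assms] by blast
  obtain \<Delta> where \<Delta>: "(step L \<AA>)\<^sup>*\<^sup>* \<Gamma> \<Delta>" "S \<subseteq> \<Delta>"
    using consequences_finite[OF S(2,1)] by blast
  then have "step L \<AA> \<Delta> (\<Delta> \<union> {C})"
    using derivable_mono[OF S(3)] by (auto simp: step_def)
  with \<Delta>(1) have "(step L \<AA>)\<^sup>*\<^sup>* \<Gamma> (\<Delta> \<union> {C})"
    by simp
  then show ?thesis
    unfolding consequences_def by blast
qed

text \<open>Otherwise compactness gives a finite unsatisfiable subset; its members are background
  parts of consequences, so a constraint refutation derives \<open>Bottom\<close>.\<close>

lemma satisfiable_background_parts:
  assumes "compact_structures L \<AA>" and "Bottom \<notin> consequences L \<AA> \<Gamma>"
  shows "satisfiable L \<AA> {Goal \<Phi> |F \<Phi>. Goal (F + \<Phi>) \<in> consequences L \<AA> \<Gamma> \<and>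
    (\<forall>M\<in>#F. \<exists>x Ms. M = apps (Free x) Ms) \<and> (\<forall>M\<in>#\<Phi>. background_atom L M)}"
    (is "satisfiable L \<AA> ?S")
proof (rule ccontr)
  assume "\<not> satisfiable L \<AA> ?S"
  moreover have "\<forall>C\<in>?S. background_goal L C"
    by (auto simp: background_goal_def)
  ultimately obtain S where S: "S \<subseteq> ?S" "finite S" "\<not> satisfiable L \<AA> S"
    using assms(1)[unfolded compact_structures_def, rule_format, of ?S] by blast
  \<comment> \<open>The rule expects a family indexed by \<open>j < n\<close>, so the finite set is
    enumerated; \<open>n = 0\<close> is allowed.\<close>
  obtain f and n :: nat where f: "S = f ` {i. i < n}"
    using finite_imp_nat_seg_image_inj_on[OF S(2)] by blast
  have "\<forall>j. \<exists>F \<Phi>. j < n \<longrightarrow> f j = Goal \<Phi> \<and> Goal (F + \<Phi>) \<in> consequences L \<AA> \<Gamma> \<and>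
      (\<forall>M\<in>#F. \<exists>x Ms. M = apps (Free x) Ms) \<and> (\<forall>M\<in>#\<Phi>. background_atom L M)"
    using S(1) unfolding f by blast
  then obtain F \<Phi> where F: "\<And>j. j < n \<Longrightarrow> f j = Goal (\<Phi> j) \<and>
      Goal (F j + \<Phi> j) \<in> consequences L \<AA> \<Gamma> \<and>
      (\<forall>M\<in>#F j. \<exists>x Ms. M = apps (Free x) Ms) \<and> (\<forall>M\<in>#\<Phi> j. background_atom L M)"
    by metis
  have "S = {Goal (\<Phi> j) |j. j < n}"
    using F unfolding f by force
  then have "\<not> satisfiable L \<AA> {Goal (\<Phi> j) |j. j < n}"
    using S(3) by simp
  then have "derivable L \<AA> (consequences L \<AA> \<Gamma>) Bottom"
    by (intro derivable.constraint_refutation[of n F \<Phi>] variants_self) (use F in auto)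
  then show False
    using consequences_closed assms(2) by blast
qed

lemma completeness:
  assumes "language L" and "\<forall>A\<in>\<AA>. fo_structure L A" and "compact_structures L \<AA>"
    and \<Gamma>: "\<forall>C\<in>\<Gamma>. hochc L C" and "Bottom \<notin> consequences L \<AA> \<Gamma>"
  shows "satisfiable L \<AA> \<Gamma>"
proof -
  let ?\<Delta> = "consequences L \<AA> \<Gamma>"
  \<comment> \<open>\<open>B\<close> may interpret the relation symbols arbitrarily; the canonical
    structure over \<open>B\<close> overrides them.\<close>
  obtain A B where AB: "A \<in> \<AA>" "expansion L A B" and
    B: "\<forall>C\<in>{Goal \<Phi> |F \<Phi>. Goal (F + \<Phi>) \<in> ?\<Delta> \<and> (\<forall>M\<in>#F. \<exists>x Ms. M = apps (Free x) Ms) \<and>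
      (\<forall>M\<in>#\<Phi>. background_atom L M)}. models L B C"
    using satisfiable_background_parts[OF assms(3,5)] unfolding satisfiable_def
    by (elim bexE exE conjE)
  have background: "models L B (Goal \<Phi>)"
    if "Goal (F + \<Phi>) \<in> ?\<Delta>" "\<forall>M\<in>#F. \<exists>x Ms. M = apps (Free x) Ms"
      "\<forall>M\<in>#\<Phi>. background_atom L M" for F \<Phi>
    by (rule B[rule_format]) (use that in blast)
  have fo: "fo_structure L A"
    using assms(2) AB(1) by blast
  have sub: "bsig L \<subseteq> sig L"
    using assms(1) by (simp add: language_def)
  interpret canonical L B \<Gamma>
  proof (intro canonical.intro canonical_axioms.intro)
    show "standard_frame L B"
      using expansion_fo_structure(1)[OF assms(1) fo AB(2)] .
    show "itp B c \<in> Dom B (cty L c)" if "c \<in> bsig L" for c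
      using expansion_fo_structure(2)[OF assms(1) fo AB(2)] that sub by blast
  qed (rule \<Gamma>)
  have \<Delta>: "\<Gamma> \<subseteq> ?\<Delta>" "\<forall>C\<in>?\<Delta>. hochc L C"
    using hochc_steps[OF _ \<Gamma>] by (auto simp: consequences_def)
  have "models L canonical_struct C" if "C \<in> \<Gamma>" for C
  proof (cases C)
    case (Goal G)
    then show ?thesis
      using models_Goal[of G ?\<Delta> \<AA>] \<Delta> consequences_closed background that by blast
  next
    case (Definite G R xs)
    then show ?thesis
      using models_Definite that by blast
  qed
  \<comment> \<open>Only symbols outside \<open>bsig L\<close> are reinterpreted, so the result
    expands \<open>A\<close> just as \<open>B\<close> does.\<close>
  moreover have "expansion L A canonical_struct"
    using AB(2) itp_canonical_struct
    by (auto simp: expansion_def) (simp add: canonical_struct_def)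
  ultimately show ?thesis
    using AB(1) unfolding satisfiable_def by blast
qed

theorem mainTheorem5:
  fixes L :: "('c, 'x) lang"
    and \<AA> :: "('c, 'v) struct set"
    and \<Gamma> :: "('c, 'x) clause set"
  assumes "language L"
    and "\<forall>A\<in>\<AA>. fo_structure L A"
    and "compact_structures L \<AA>"
    and "\<forall>C\<in>\<Gamma>. hochc L C"
  shows "\<not> satisfiable L \<AA> \<Gamma> \<longleftrightarrow> (\<exists>\<Gamma>'. (step L \<AA>)\<^sup>*\<^sup>* \<Gamma> (\<Gamma>' \<union> {Bottom}))"
proof
  assume "\<not> satisfiable L \<AA> \<Gamma>"
  then have "Bottom \<in> consequences L \<AA> \<Gamma>"
    using completeness[OF assms] by blast
  then obtain \<Delta> where "(step L \<AA>)\<^sup>*\<^sup>* \<Gamma> \<Delta>" "Bottom \<in> \<Delta>"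
    by (auto simp: consequences_def)
  then show "\<exists>\<Gamma>'. (step L \<AA>)\<^sup>*\<^sup>* \<Gamma> (\<Gamma>' \<union> {Bottom})"
    by (intro exI[of _ \<Delta>]) (simp add: insert_absorb)
qed (use steps_sound[OF assms(1,2,4)] in blast)

end
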